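(* The restriction $H^*\restriction_{\mathbf{gCat}}:\mathbf{gCat}\to\mathbf{bCat}^*$ of the decorated horizontalization functor to the category of globularly generated double categories is faithful.
   Context: Double categories. A double category $C$ (possibly weak in the horizontal direction) consists of a category $C_0$ (objects and vertical morphisms), a category $C_1$ (horizontal morphisms and squares; composition in $C_1$ is vertical composition), functors $s,t:C_1\to C_0$ (left and right edge), a horizontal identity functor $i:C_0\to C_1$ (its value on a vertical morphism $f$ is the square $i_f$), a horizontal composition functor $*:C_1\times_{C_0}C_1\to C_1$, and invertible globular associator and left/right unitor natural transformations satisfying the usual coherence axioms. A square is globular if its left and right edges are identity vertical morphisms. $HC$ denotes the horizontal bicategory of $C$: 0-cells, 1-cells, 2-cells are the objects, horizontal morphisms, globular squares of $C$. A double functor $F:C\to C'$ is a pair of functors $F_0:C_0\to C_0'$, $F_1:C_1\to C_1'$ commuting with $s,t$ and compatible with $i$ and $*$ up to specified coherent invertible globular squares. A decorated bicategory $\mathcal{B}$ is a bicategory together with a category $\mathcal{B}^*$ (the decoration) whose objects are the 0-cells of $\mathcal{B}$. A decorated pseudofunctor $G:\mathcal{B}\to\mathcal{B}'$ is a pseudofunctor together with a functor $G^*:\mathcal{B}^*\to\mathcal{B}'^*$ agreeing with it on 0-cells. For a double category $C$, $H^*C$ is $HC$ decorated by $C_0$; for a double functor $F$, $H^*F$ is the decorated pseudofunctor given by $F_0$ and the restriction of $F$ (with its coherence data) to horizontal morphisms and globular squares. $C$ is globularly generated if every square of $C$ can be obtained by vertical and horizontal compositions from globular squares and squares $i_f$,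 $f$ a vertical morphism. $\mathbf{bCat}^*$ is the category of decorated bicategories and decorated pseudofunctors; $\mathbf{gCat}$ is the category of globularly generated double categories and double functors. *)

theory Defs
  imports Main "HOL-Library.FuncSet"
begin

section \<open>Categories and functors\<close>

text \<open>
  Composition is written in applicative order: \<open>g \<cdot>\<^bsub>A\<^esub> f\<close> is \<open>g\<close> after \<open>f\<close>. The operations of a
  category are only meaningful on its sets of objects and arrows.
\<close>

record ('a, 'f) cat =
  Obj :: "'a set"
  Arr :: "'f set"
  Dom :: "'f \<Rightarrow> 'a"
  Cod :: "'f \<Rightarrow> 'a"
  Id :: "'a \<Rightarrow> 'f"
  Comp :: "'f \<Rightarrow> 'f \<Rightarrow> 'f" (infixr "\<cdot>\<index>" 55)

locale category =
  fixes A :: "('a, 'f) cat"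
  assumes Dom_Obj: "f \<in> Arr A \<Longrightarrow> Dom A f \<in> Obj A"
    and Cod_Obj: "f \<in> Arr A \<Longrightarrow> Cod A f \<in> Obj A"
    and Id_Arr: "a \<in> Obj A \<Longrightarrow> Id A a \<in> Arr A"
    and Dom_Id: "a \<in> Obj A \<Longrightarrow> Dom A (Id A a) = a"
    and Cod_Id: "a \<in> Obj A \<Longrightarrow> Cod A (Id A a) = a"
    and Comp_Arr: "\<lbrakk>f \<in> Arr A; g \<in> Arr A; Dom A g = Cod A f\<rbrakk> \<Longrightarrow> g \<cdot>\<^bsub>A\<^esub> f \<in> Arr A"
    and Dom_Comp: "\<lbrakk>f \<in> Arr A; g \<in> Arr A; Dom A g = Cod A f\<rbrakk> \<Longrightarrow> Dom A (g \<cdot>\<^bsub>A\<^esub> f) = Dom A f"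
    and Cod_Comp: "\<lbrakk>f \<in> Arr A; g \<in> Arr A; Dom A g = Cod A f\<rbrakk> \<Longrightarrow> Cod A (g \<cdot>\<^bsub>A\<^esub> f) = Cod A g"
    and Comp_Id: "f \<in> Arr A \<Longrightarrow> f \<cdot>\<^bsub>A\<^esub> Id A (Dom A f) = f"
    and Id_Comp: "f \<in> Arr A \<Longrightarrow> Id A (Cod A f) \<cdot>\<^bsub>A\<^esub> f = f"
    and Comp_assoc: "\<lbrakk>f \<in> Arr A; g \<in> Arr A; h \<in> Arr A; Dom A g = Cod A f; Dom A h = Cod A g\<rbrakk>
      \<Longrightarrow> (h \<cdot>\<^bsub>A\<^esub> g) \<cdot>\<^bsub>A\<^esub> f = h \<cdot>\<^bsub>A\<^esub> (g \<cdot>\<^bsub>A\<^esub> f)"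

definition iso_arr :: "('a, 'f) cat \<Rightarrow> 'f \<Rightarrow> bool" where
  "iso_arr A f \<longleftrightarrow> f \<in> Arr A \<and> (\<exists>g\<in>Arr A. Dom A g = Cod A f \<and> Cod A g = Dom A f \<and>
     g \<cdot>\<^bsub>A\<^esub> f = Id A (Dom A f) \<and> f \<cdot>\<^bsub>A\<^esub> g = Id A (Cod A f))"

record ('a, 'f, 'b, 'g) fctr =
  ObF :: "'a \<Rightarrow> 'b"
  ArF :: "'f \<Rightarrow> 'g"

locale cat_functor = A: category A + B: category B
  for A :: "('a, 'f) cat" and B :: "('b, 'g) cat" +
  fixes F :: "('a, 'f, 'b, 'g) fctr"
  assumes ObF_Obj: "a \<in> Obj A \<Longrightarrow> ObF F a \<in> Obj B"
    and ArF_Arr: "f \<in> Arr A \<Longrightarrow> ArF F f \<in> Arr B"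
    and Dom_ArF: "f \<in> Arr A \<Longrightarrow> Dom B (ArF F f) = ObF F (Dom A f)"
    and Cod_ArF: "f \<in> Arr A \<Longrightarrow> Cod B (ArF F f) = ObF F (Cod A f)"
    and ArF_Id: "a \<in> Obj A \<Longrightarrow> ArF F (Id A a) = Id B (ObF F a)"
    and ArF_Comp: "\<lbrakk>f \<in> Arr A; g \<in> Arr A; Dom A g = Cod A f\<rbrakk>
      \<Longrightarrow> ArF F (g \<cdot>\<^bsub>A\<^esub> f) = ArF F g \<cdot>\<^bsub>B\<^esub> ArF F f"

locale faithful_functor = cat_functor A B F
  for A :: "('a, 'f) cat" and B :: "('b, 'g) cat" and F :: "('a, 'f, 'b, 'g) fctr" +
  assumes faithful: "\<lbrakk>f \<in> Arr A; g \<in> Arr A; Dom A f = Dom A g; Cod A f = Cod A g;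
    ArF F f = ArF F g\<rbrakk> \<Longrightarrow> f = g"

definition full_subcat :: "('a, 'f) cat \<Rightarrow> 'a set \<Rightarrow> ('a, 'f) cat" where
  "full_subcat A X = A\<lparr>Obj := Obj A \<inter> X, Arr := {f \<in> Arr A. Dom A f \<in> X \<and> Cod A f \<in> X}\<rparr>"

text \<open>The (strict) pullback of two functors with a common codomain.\<close>

definition fiber_product ::
  "('a, 'f) cat \<Rightarrow> ('b, 'g) cat \<Rightarrow> ('a, 'f, 'c, 'k) fctr \<Rightarrow> ('b, 'g, 'c, 'k) fctr
    \<Rightarrow> ('a \<times> 'b, 'f \<times> 'g) cat" where
  "fiber_product A B F G =
    \<lparr>Obj = {(a, b). a \<in> Obj A \<and> b \<in> Obj B \<and> ObF F a = ObF G b},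
     Arr = {(f, g). f \<in> Arr A \<and> g \<in> Arr B \<and> ArF F f = ArF G g},
     Dom = (\<lambda>(f, g). (Dom A f, Dom B g)),
     Cod = (\<lambda>(f, g). (Cod A f, Cod B g)),
     Id = (\<lambda>(a, b). (Id A a, Id B b)),
     Comp = (\<lambda>(f', g') (f, g). (f' \<cdot>\<^bsub>A\<^esub> f, g' \<cdot>\<^bsub>B\<^esub> g))\<rparr>"

text \<open>
  A horizontal composition is a functor \<open>H\<close> defined on a category of composable pairs; the two
  notations below are its values on 1-cells and on squares (or 2-cells).
\<close>

abbreviation hcomp1 :: "'h \<Rightarrow> ('h \<times> 'h, 's \<times> 's, 'h, 's) fctr \<Rightarrow> 'h \<Rightarrow> 'h" ("_ \<star>\<^bsub>_\<^esub> _" [61, 0, 60] 60) where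
  "g \<star>\<^bsub>H\<^esub> f \<equiv> ObF H (g, f)"

abbreviation hcomp2 :: "'s \<Rightarrow> ('h \<times> 'h, 's \<times> 's, 'h, 's) fctr \<Rightarrow> 's \<Rightarrow> 's" ("_ \<odot>\<^bsub>_\<^esub> _" [61, 0, 60] 60) where
  "\<beta> \<odot>\<^bsub>H\<^esub> \<alpha> \<equiv> ArF H (\<beta>, \<alpha>)"

text \<open>
  Functors that are components of morphisms of double categories or bicategories are normalised to
  \<^const>\<open>undefined\<close> outside their domain, so that equality of records is equality of morphisms.
\<close>

definition ext_functor :: "('a, 'f) cat \<Rightarrow> ('a, 'f, 'b, 'g) fctr \<Rightarrow> bool" where
  "ext_functor A F \<longleftrightarrow> ObF F \<in> extensional (Obj A) \<and> ArF F \<in> extensional (Arr A)"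

definition id_functor :: "('a, 'f) cat \<Rightarrow> ('a, 'f, 'a, 'f) fctr" where
  "id_functor A = \<lparr>ObF = restrict id (Obj A), ArF = restrict id (Arr A)\<rparr>"

definition comp_functor :: "('a, 'f) cat \<Rightarrow> ('b, 'g, 'c, 'k) fctr \<Rightarrow> ('a, 'f, 'b, 'g) fctr
    \<Rightarrow> ('a, 'f, 'c, 'k) fctr" where
  "comp_functor A G F =
    \<lparr>ObF = compose (Obj A) (ObF G) (ObF F), ArF = compose (Arr A) (ArF G) (ArF F)\<rparr>"


section \<open>Double categories\<close>

text \<open>
  \<open>C0\<close> has the objects and vertical morphisms, \<open>C1\<close> the horizontal morphisms and squares, and the
  composition of \<open>C1\<close> is vertical composition of squares. The horizontal composite \<open>g \<star> f\<close> is
  defined when the source of \<open>g\<close> is the target of \<open>f\<close>. The associator component \<open>Assoc h g f\<close> goes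
  from \<open>(h \<star> g) \<star> f\<close> to \<open>h \<star> (g \<star> f)\<close>.
\<close>

record ('o, 'v, 'h, 's) dbl_cat =
  C0 :: "('o, 'v) cat"
  C1 :: "('h, 's) cat"
  Src :: "('h, 's, 'o, 'v) fctr"
  Tgt :: "('h, 's, 'o, 'v) fctr"
  HId :: "('o, 'v, 'h, 's) fctr"
  HComp :: "('h \<times> 'h, 's \<times> 's, 'h, 's) fctr"
  Assoc :: "'h \<Rightarrow> 'h \<Rightarrow> 'h \<Rightarrow> 's"
  LUnit :: "'h \<Rightarrow> 's"
  RUnit :: "'h \<Rightarrow> 's"

definition comp_pairs :: "('o, 'v, 'h, 's) dbl_cat \<Rightarrow> ('h \<times> 'h, 's \<times> 's) cat" where
  "comp_pairs C = fiber_product (C1 C) (C1 C) (Src C) (Tgt C)"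

definition globular :: "('o, 'v, 'h, 's) dbl_cat \<Rightarrow> 's set" where
  "globular C = {\<alpha> \<in> Arr (C1 C). ArF (Src C) \<alpha> \<in> Id (C0 C) ` Obj (C0 C) \<and>
     ArF (Tgt C) \<alpha> \<in> Id (C0 C) ` Obj (C0 C)}"

locale double_category =
  Src: cat_functor "C1 C" "C0 C" "Src C" +
  Tgt: cat_functor "C1 C" "C0 C" "Tgt C" +
  HId: cat_functor "C0 C" "C1 C" "HId C" +
  HComp: cat_functor "comp_pairs C" "C1 C" "HComp C"
  for C :: "('o, 'v, 'h, 's) dbl_cat" +
  assumes Src_HId: "a \<in> Obj (C0 C) \<Longrightarrow> ObF (Src C) (ObF (HId C) a) = a"
      "v \<in> Arr (C0 C) \<Longrightarrow> ArF (Src C) (ArF (HId C) v) = v"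
    and Tgt_HId: "a \<in> Obj (C0 C) \<Longrightarrow> ObF (Tgt C) (ObF (HId C) a) = a"
      "v \<in> Arr (C0 C) \<Longrightarrow> ArF (Tgt C) (ArF (HId C) v) = v"
    and Src_HComp:
      "(g, f) \<in> Obj (comp_pairs C) \<Longrightarrow> ObF (Src C) (g \<star>\<^bsub>HComp C\<^esub> f) = ObF (Src C) f"
      "(\<beta>, \<alpha>) \<in> Arr (comp_pairs C) \<Longrightarrow> ArF (Src C) (\<beta> \<odot>\<^bsub>HComp C\<^esub> \<alpha>) = ArF (Src C) \<alpha>"
    and Tgt_HComp:
      "(g, f) \<in> Obj (comp_pairs C) \<Longrightarrow> ObF (Tgt C) (g \<star>\<^bsub>HComp C\<^esub> f) = ObF (Tgt C) g"
      "(\<beta>, \<alpha>) \<in> Arr (comp_pairs C) \<Longrightarrow> ArF (Tgt C) (\<beta> \<odot>\<^bsub>HComp C\<^esub> \<alpha>) = ArF (Tgt C) \<beta>"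
    and Assoc_cell:
      "\<lbrakk>(h, g) \<in> Obj (comp_pairs C); (g, f) \<in> Obj (comp_pairs C)\<rbrakk> \<Longrightarrow>
        Assoc C h g f \<in> globular C \<and> iso_arr (C1 C) (Assoc C h g f) \<and>
        Dom (C1 C) (Assoc C h g f) = (h \<star>\<^bsub>HComp C\<^esub> g) \<star>\<^bsub>HComp C\<^esub> f \<and>
        Cod (C1 C) (Assoc C h g f) = h \<star>\<^bsub>HComp C\<^esub> (g \<star>\<^bsub>HComp C\<^esub> f)"
    and LUnit_cell:
      "f \<in> Obj (C1 C) \<Longrightarrow>
        LUnit C f \<in> globular C \<and> iso_arr (C1 C) (LUnit C f) \<and>
        Dom (C1 C) (LUnit C f) = ObF (HId C) (ObF (Tgt C) f) \<star>\<^bsub>HComp C\<^esub> f \<and>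
        Cod (C1 C) (LUnit C f) = f"
    and RUnit_cell:
      "f \<in> Obj (C1 C) \<Longrightarrow>
        RUnit C f \<in> globular C \<and> iso_arr (C1 C) (RUnit C f) \<and>
        Dom (C1 C) (RUnit C f) = f \<star>\<^bsub>HComp C\<^esub> ObF (HId C) (ObF (Src C) f) \<and>
        Cod (C1 C) (RUnit C f) = f"
    and Assoc_natural:
      "\<lbrakk>(\<gamma>, \<beta>) \<in> Arr (comp_pairs C); (\<beta>, \<alpha>) \<in> Arr (comp_pairs C)\<rbrakk> \<Longrightarrow>
        Assoc C (Cod (C1 C) \<gamma>) (Cod (C1 C) \<beta>) (Cod (C1 C) \<alpha>) \<cdot>\<^bsub>C1 C\<^esub>
          ((\<gamma> \<odot>\<^bsub>HComp C\<^esub> \<beta>) \<odot>\<^bsub>HComp C\<^esub> \<alpha>) =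
        (\<gamma> \<odot>\<^bsub>HComp C\<^esub> (\<beta> \<odot>\<^bsub>HComp C\<^esub> \<alpha>)) \<cdot>\<^bsub>C1 C\<^esub>
          Assoc C (Dom (C1 C) \<gamma>) (Dom (C1 C) \<beta>) (Dom (C1 C) \<alpha>)"
    and LUnit_natural:
      "\<alpha> \<in> Arr (C1 C) \<Longrightarrow>
        LUnit C (Cod (C1 C) \<alpha>) \<cdot>\<^bsub>C1 C\<^esub> (ArF (HId C) (ArF (Tgt C) \<alpha>) \<odot>\<^bsub>HComp C\<^esub> \<alpha>) =
        \<alpha> \<cdot>\<^bsub>C1 C\<^esub> LUnit C (Dom (C1 C) \<alpha>)"
    and RUnit_natural:
      "\<alpha> \<in> Arr (C1 C) \<Longrightarrow>
        RUnit C (Cod (C1 C) \<alpha>) \<cdot>\<^bsub>C1 C\<^esub> (\<alpha> \<odot>\<^bsub>HComp C\<^esub> ArF (HId C) (ArF (Src C) \<alpha>)) =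
        \<alpha> \<cdot>\<^bsub>C1 C\<^esub> RUnit C (Dom (C1 C) \<alpha>)"
    and pentagon:
      "\<lbrakk>(k, h) \<in> Obj (comp_pairs C); (h, g) \<in> Obj (comp_pairs C); (g, f) \<in> Obj (comp_pairs C)\<rbrakk> \<Longrightarrow>
        Assoc C k h (g \<star>\<^bsub>HComp C\<^esub> f) \<cdot>\<^bsub>C1 C\<^esub> Assoc C (k \<star>\<^bsub>HComp C\<^esub> h) g f =
        (Id (C1 C) k \<odot>\<^bsub>HComp C\<^esub> Assoc C h g f) \<cdot>\<^bsub>C1 C\<^esub> Assoc C k (h \<star>\<^bsub>HComp C\<^esub> g) f \<cdot>\<^bsub>C1 C\<^esub>
          (Assoc C k h g \<odot>\<^bsub>HComp C\<^esub> Id (C1 C) f)"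
    and triangle:
      "(g, f) \<in> Obj (comp_pairs C) \<Longrightarrow>
        (Id (C1 C) g \<odot>\<^bsub>HComp C\<^esub> LUnit C f) \<cdot>\<^bsub>C1 C\<^esub>
          Assoc C g (ObF (HId C) (ObF (Tgt C) f)) f =
        RUnit C g \<odot>\<^bsub>HComp C\<^esub> Id (C1 C) f"

inductive_set generated_squares :: "('o, 'v, 'h, 's) dbl_cat \<Rightarrow> 's set"
  for C :: "('o, 'v, 'h, 's) dbl_cat" where
  glob: "\<alpha> \<in> globular C \<Longrightarrow> \<alpha> \<in> generated_squares C"
| hid: "v \<in> Arr (C0 C) \<Longrightarrow> ArF (HId C) v \<in> generated_squares C"
| vert: "\<lbrakk>\<alpha> \<in> generated_squares C; \<beta> \<in> generated_squares C; Dom (C1 C) \<beta> = Cod (C1 C) \<alpha>\<rbrakk>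
    \<Longrightarrow> \<beta> \<cdot>\<^bsub>C1 C\<^esub> \<alpha> \<in> generated_squares C"
| horiz: "\<lbrakk>\<alpha> \<in> generated_squares C; \<beta> \<in> generated_squares C; ArF (Src C) \<beta> = ArF (Tgt C) \<alpha>\<rbrakk>
    \<Longrightarrow> \<beta> \<odot>\<^bsub>HComp C\<^esub> \<alpha> \<in> generated_squares C"

definition globularly_generated :: "('o, 'v, 'h, 's) dbl_cat \<Rightarrow> bool" where
  "globularly_generated C \<longleftrightarrow> Arr (C1 C) \<subseteq> generated_squares C"


section \<open>Double functors\<close>

text \<open>
  Double functors are pseudo: \<open>FUnit F a\<close> goes from \<open>i\<^bsub>F a\<^esub>\<close> to \<open>F i\<^bsub>a\<^esub>\<close>, and \<open>FMult F (g, f)\<close> from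
  \<open>F g \<star> F f\<close> to \<open>F (g \<star> f)\<close>.
\<close>

record ('o, 'v, 'h, 's, 'o2, 'v2, 'h2, 's2) dbl_fun =
  F0 :: "('o, 'v, 'o2, 'v2) fctr"
  F1 :: "('h, 's, 'h2, 's2) fctr"
  FUnit :: "'o \<Rightarrow> 's2"
  FMult :: "'h \<times> 'h \<Rightarrow> 's2"

locale double_functor =
  C: double_category C + D: double_category D +
  F0: cat_functor "C0 C" "C0 D" "F0 F" +
  F1: cat_functor "C1 C" "C1 D" "F1 F"
  for C :: "('o, 'v, 'h, 's) dbl_cat" and D :: "('o2, 'v2, 'h2, 's2) dbl_cat"
    and F :: "('o, 'v, 'h, 's, 'o2, 'v2, 'h2, 's2) dbl_fun" +
  assumes Src_F1:
      "f \<in> Obj (C1 C) \<Longrightarrow> ObF (Src D) (ObF (F1 F) f) = ObF (F0 F) (ObF (Src C) f)"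
      "\<alpha> \<in> Arr (C1 C) \<Longrightarrow> ArF (Src D) (ArF (F1 F) \<alpha>) = ArF (F0 F) (ArF (Src C) \<alpha>)"
    and Tgt_F1:
      "f \<in> Obj (C1 C) \<Longrightarrow> ObF (Tgt D) (ObF (F1 F) f) = ObF (F0 F) (ObF (Tgt C) f)"
      "\<alpha> \<in> Arr (C1 C) \<Longrightarrow> ArF (Tgt D) (ArF (F1 F) \<alpha>) = ArF (F0 F) (ArF (Tgt C) \<alpha>)"
    and FUnit_cell:
      "a \<in> Obj (C0 C) \<Longrightarrow>
        FUnit F a \<in> globular D \<and> iso_arr (C1 D) (FUnit F a) \<and>
        Dom (C1 D) (FUnit F a) = ObF (HId D) (ObF (F0 F) a) \<and>
        Cod (C1 D) (FUnit F a) = ObF (F1 F) (ObF (HId C) a)"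
    and FMult_cell:
      "(g, f) \<in> Obj (comp_pairs C) \<Longrightarrow>
        FMult F (g, f) \<in> globular D \<and> iso_arr (C1 D) (FMult F (g, f)) \<and>
        Dom (C1 D) (FMult F (g, f)) = ObF (F1 F) g \<star>\<^bsub>HComp D\<^esub> ObF (F1 F) f \<and>
        Cod (C1 D) (FMult F (g, f)) = ObF (F1 F) (g \<star>\<^bsub>HComp C\<^esub> f)"
    and FUnit_natural:
      "v \<in> Arr (C0 C) \<Longrightarrow>
        FUnit F (Cod (C0 C) v) \<cdot>\<^bsub>C1 D\<^esub> ArF (HId D) (ArF (F0 F) v) =
        ArF (F1 F) (ArF (HId C) v) \<cdot>\<^bsub>C1 D\<^esub> FUnit F (Dom (C0 C) v)"
    and FMult_natural:
      "(\<beta>, \<alpha>) \<in> Arr (comp_pairs C) \<Longrightarrow>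
        FMult F (Cod (C1 C) \<beta>, Cod (C1 C) \<alpha>) \<cdot>\<^bsub>C1 D\<^esub> (ArF (F1 F) \<beta> \<odot>\<^bsub>HComp D\<^esub> ArF (F1 F) \<alpha>) =
        ArF (F1 F) (\<beta> \<odot>\<^bsub>HComp C\<^esub> \<alpha>) \<cdot>\<^bsub>C1 D\<^esub> FMult F (Dom (C1 C) \<beta>, Dom (C1 C) \<alpha>)"
    and Assoc_coherence:
      "\<lbrakk>(h, g) \<in> Obj (comp_pairs C); (g, f) \<in> Obj (comp_pairs C)\<rbrakk> \<Longrightarrow>
        ArF (F1 F) (Assoc C h g f) \<cdot>\<^bsub>C1 D\<^esub> FMult F (h \<star>\<^bsub>HComp C\<^esub> g, f) \<cdot>\<^bsub>C1 D\<^esub>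
          (FMult F (h, g) \<odot>\<^bsub>HComp D\<^esub> Id (C1 D) (ObF (F1 F) f)) =
        FMult F (h, g \<star>\<^bsub>HComp C\<^esub> f) \<cdot>\<^bsub>C1 D\<^esub>
          (Id (C1 D) (ObF (F1 F) h) \<odot>\<^bsub>HComp D\<^esub> FMult F (g, f)) \<cdot>\<^bsub>C1 D\<^esub>
          Assoc D (ObF (F1 F) h) (ObF (F1 F) g) (ObF (F1 F) f)"
    and LUnit_coherence:
      "f \<in> Obj (C1 C) \<Longrightarrow>
        ArF (F1 F) (LUnit C f) \<cdot>\<^bsub>C1 D\<^esub> FMult F (ObF (HId C) (ObF (Tgt C) f), f) \<cdot>\<^bsub>C1 D\<^esub>
          (FUnit F (ObF (Tgt C) f) \<odot>\<^bsub>HComp D\<^esub> Id (C1 D) (ObF (F1 F) f)) =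
        LUnit D (ObF (F1 F) f)"
    and RUnit_coherence:
      "f \<in> Obj (C1 C) \<Longrightarrow>
        ArF (F1 F) (RUnit C f) \<cdot>\<^bsub>C1 D\<^esub> FMult F (f, ObF (HId C) (ObF (Src C) f)) \<cdot>\<^bsub>C1 D\<^esub>
          (Id (C1 D) (ObF (F1 F) f) \<odot>\<^bsub>HComp D\<^esub> FUnit F (ObF (Src C) f)) =
        RUnit D (ObF (F1 F) f)"
    and ext: "ext_functor (C0 C) (F0 F)" "ext_functor (C1 C) (F1 F)"
      "FUnit F \<in> extensional (Obj (C0 C))" "FMult F \<in> extensional (Obj (comp_pairs C))"

definition id_dbl_fun :: "('o, 'v, 'h, 's) dbl_cat \<Rightarrow> ('o, 'v, 'h, 's, 'o, 'v, 'h, 's) dbl_fun" where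
  "id_dbl_fun C =
    \<lparr>F0 = id_functor (C0 C), F1 = id_functor (C1 C),
     FUnit = restrict (\<lambda>a. Id (C1 C) (ObF (HId C) a)) (Obj (C0 C)),
     FMult = restrict (\<lambda>(g, f). Id (C1 C) (g \<star>\<^bsub>HComp C\<^esub> f)) (Obj (comp_pairs C))\<rparr>"

definition comp_dbl_fun ::
  "('o, 'v, 'h, 's) dbl_cat \<Rightarrow> ('o3, 'v3, 'h3, 's3) dbl_cat
    \<Rightarrow> ('o2, 'v2, 'h2, 's2, 'o3, 'v3, 'h3, 's3) dbl_fun
    \<Rightarrow> ('o, 'v, 'h, 's, 'o2, 'v2, 'h2, 's2) dbl_fun
    \<Rightarrow> ('o, 'v, 'h, 's, 'o3, 'v3, 'h3, 's3) dbl_fun" where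
  "comp_dbl_fun C E G F =
    \<lparr>F0 = comp_functor (C0 C) (F0 G) (F0 F), F1 = comp_functor (C1 C) (F1 G) (F1 F),
     FUnit = restrict (\<lambda>a. ArF (F1 G) (FUnit F a) \<cdot>\<^bsub>C1 E\<^esub> FUnit G (ObF (F0 F) a)) (Obj (C0 C)),
     FMult = restrict (\<lambda>(g, f). ArF (F1 G) (FMult F (g, f)) \<cdot>\<^bsub>C1 E\<^esub>
       FMult G (ObF (F1 F) g, ObF (F1 F) f)) (Obj (comp_pairs C))\<rparr>"


section \<open>Decorated bicategories\<close>

text \<open>
  The hom-categories of a bicategory are given together, as a single category \<open>B1\<close> of 1-cells and
  2-cells in which the source and target 0-cells of 1-cells are constant along 2-cells.
\<close>

record ('o, 'h, 's) bicat =
  B0 :: "'o set"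
  B1 :: "('h, 's) cat"
  BSrc :: "'h \<Rightarrow> 'o"
  BTgt :: "'h \<Rightarrow> 'o"
  BId :: "'o \<Rightarrow> 'h"
  BComp :: "('h \<times> 'h, 's \<times> 's, 'h, 's) fctr"
  BAssoc :: "'h \<Rightarrow> 'h \<Rightarrow> 'h \<Rightarrow> 's"
  BLUnit :: "'h \<Rightarrow> 's"
  BRUnit :: "'h \<Rightarrow> 's"

text \<open>A 0-cell assignment viewed as a functor to a discrete category (arrows = objects).\<close>

definition discrete_fctr :: "('h, 's) cat \<Rightarrow> ('h \<Rightarrow> 'o) \<Rightarrow> ('h, 's, 'o, 'o) fctr" where
  "discrete_fctr A p = \<lparr>ObF = p, ArF = (\<lambda>\<alpha>. p (Dom A \<alpha>))\<rparr>"

definition bcomp_pairs :: "('o, 'h, 's) bicat \<Rightarrow> ('h \<times> 'h, 's \<times> 's) cat" where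
  "bcomp_pairs B = fiber_product (B1 B) (B1 B) (discrete_fctr (B1 B) (BSrc B))
     (discrete_fctr (B1 B) (BTgt B))"

locale bicategory =
  B1: category "B1 B" +
  BComp: cat_functor "bcomp_pairs B" "B1 B" "BComp B"
  for B :: "('o, 'h, 's) bicat" +
  assumes BSrc_B0: "f \<in> Obj (B1 B) \<Longrightarrow> BSrc B f \<in> B0 B"
    and BTgt_B0: "f \<in> Obj (B1 B) \<Longrightarrow> BTgt B f \<in> B0 B"
    and BSrc_2cell: "\<alpha> \<in> Arr (B1 B) \<Longrightarrow> BSrc B (Cod (B1 B) \<alpha>) = BSrc B (Dom (B1 B) \<alpha>)"
    and BTgt_2cell: "\<alpha> \<in> Arr (B1 B) \<Longrightarrow> BTgt B (Cod (B1 B) \<alpha>) = BTgt B (Dom (B1 B) \<alpha>)"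
    and BId_Obj: "a \<in> B0 B \<Longrightarrow> BId B a \<in> Obj (B1 B)"
    and BSrc_BId: "a \<in> B0 B \<Longrightarrow> BSrc B (BId B a) = a"
    and BTgt_BId: "a \<in> B0 B \<Longrightarrow> BTgt B (BId B a) = a"
    and BSrc_BComp: "(g, f) \<in> Obj (bcomp_pairs B) \<Longrightarrow> BSrc B (g \<star>\<^bsub>BComp B\<^esub> f) = BSrc B f"
    and BTgt_BComp: "(g, f) \<in> Obj (bcomp_pairs B) \<Longrightarrow> BTgt B (g \<star>\<^bsub>BComp B\<^esub> f) = BTgt B g"
    and BAssoc_cell:
      "\<lbrakk>(h, g) \<in> Obj (bcomp_pairs B); (g, f) \<in> Obj (bcomp_pairs B)\<rbrakk> \<Longrightarrow>
        iso_arr (B1 B) (BAssoc B h g f) \<and>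
        Dom (B1 B) (BAssoc B h g f) = (h \<star>\<^bsub>BComp B\<^esub> g) \<star>\<^bsub>BComp B\<^esub> f \<and>
        Cod (B1 B) (BAssoc B h g f) = h \<star>\<^bsub>BComp B\<^esub> (g \<star>\<^bsub>BComp B\<^esub> f)"
    and BLUnit_cell:
      "f \<in> Obj (B1 B) \<Longrightarrow>
        iso_arr (B1 B) (BLUnit B f) \<and>
        Dom (B1 B) (BLUnit B f) = BId B (BTgt B f) \<star>\<^bsub>BComp B\<^esub> f \<and>
        Cod (B1 B) (BLUnit B f) = f"
    and BRUnit_cell:
      "f \<in> Obj (B1 B) \<Longrightarrow>
        iso_arr (B1 B) (BRUnit B f) \<and>
        Dom (B1 B) (BRUnit B f) = f \<star>\<^bsub>BComp B\<^esub> BId B (BSrc B f) \<and>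
        Cod (B1 B) (BRUnit B f) = f"
    and BAssoc_natural:
      "\<lbrakk>(\<gamma>, \<beta>) \<in> Arr (bcomp_pairs B); (\<beta>, \<alpha>) \<in> Arr (bcomp_pairs B)\<rbrakk> \<Longrightarrow>
        BAssoc B (Cod (B1 B) \<gamma>) (Cod (B1 B) \<beta>) (Cod (B1 B) \<alpha>) \<cdot>\<^bsub>B1 B\<^esub>
          ((\<gamma> \<odot>\<^bsub>BComp B\<^esub> \<beta>) \<odot>\<^bsub>BComp B\<^esub> \<alpha>) =
        (\<gamma> \<odot>\<^bsub>BComp B\<^esub> (\<beta> \<odot>\<^bsub>BComp B\<^esub> \<alpha>)) \<cdot>\<^bsub>B1 B\<^esub>
          BAssoc B (Dom (B1 B) \<gamma>) (Dom (B1 B) \<beta>) (Dom (B1 B) \<alpha>)"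
    and BLUnit_natural:
      "\<alpha> \<in> Arr (B1 B) \<Longrightarrow>
        BLUnit B (Cod (B1 B) \<alpha>) \<cdot>\<^bsub>B1 B\<^esub>
          (Id (B1 B) (BId B (BTgt B (Dom (B1 B) \<alpha>))) \<odot>\<^bsub>BComp B\<^esub> \<alpha>) =
        \<alpha> \<cdot>\<^bsub>B1 B\<^esub> BLUnit B (Dom (B1 B) \<alpha>)"
    and BRUnit_natural:
      "\<alpha> \<in> Arr (B1 B) \<Longrightarrow>
        BRUnit B (Cod (B1 B) \<alpha>) \<cdot>\<^bsub>B1 B\<^esub>
          (\<alpha> \<odot>\<^bsub>BComp B\<^esub> Id (B1 B) (BId B (BSrc B (Dom (B1 B) \<alpha>)))) =
        \<alpha> \<cdot>\<^bsub>B1 B\<^esub> BRUnit B (Dom (B1 B) \<alpha>)"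
    and bpentagon:
      "\<lbrakk>(k, h) \<in> Obj (bcomp_pairs B); (h, g) \<in> Obj (bcomp_pairs B); (g, f) \<in> Obj (bcomp_pairs B)\<rbrakk> \<Longrightarrow>
        BAssoc B k h (g \<star>\<^bsub>BComp B\<^esub> f) \<cdot>\<^bsub>B1 B\<^esub> BAssoc B (k \<star>\<^bsub>BComp B\<^esub> h) g f =
        (Id (B1 B) k \<odot>\<^bsub>BComp B\<^esub> BAssoc B h g f) \<cdot>\<^bsub>B1 B\<^esub> BAssoc B k (h \<star>\<^bsub>BComp B\<^esub> g) f \<cdot>\<^bsub>B1 B\<^esub>
          (BAssoc B k h g \<odot>\<^bsub>BComp B\<^esub> Id (B1 B) f)"
    and btriangle:
      "(g, f) \<in> Obj (bcomp_pairs B) \<Longrightarrow>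
        (Id (B1 B) g \<odot>\<^bsub>BComp B\<^esub> BLUnit B f) \<cdot>\<^bsub>B1 B\<^esub> BAssoc B g (BId B (BTgt B f)) f =
        BRUnit B g \<odot>\<^bsub>BComp B\<^esub> Id (B1 B) f"

record ('o, 'v, 'h, 's) dec_bicat =
  Bic :: "('o, 'h, 's) bicat"
  Dec :: "('o, 'v) cat"

locale decorated_bicategory =
  Bic: bicategory "Bic B" + Dec: category "Dec B"
  for B :: "('o, 'v, 'h, 's) dec_bicat" +
  assumes Obj_Dec: "Obj (Dec B) = B0 (Bic B)"

record ('o, 'h, 's, 'o2, 'h2, 's2) psfun =
  P0 :: "'o \<Rightarrow> 'o2"
  P1 :: "('h, 's, 'h2, 's2) fctr"
  PUnit :: "'o \<Rightarrow> 's2"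
  PMult :: "'h \<times> 'h \<Rightarrow> 's2"

locale pseudofunctor =
  A: bicategory A + B: bicategory B +
  P1: cat_functor "B1 A" "B1 B" "P1 P"
  for A :: "('o, 'h, 's) bicat" and B :: "('o2, 'h2, 's2) bicat"
    and P :: "('o, 'h, 's, 'o2, 'h2, 's2) psfun" +
  assumes P0_B0: "a \<in> B0 A \<Longrightarrow> P0 P a \<in> B0 B"
    and BSrc_P1: "f \<in> Obj (B1 A) \<Longrightarrow> BSrc B (ObF (P1 P) f) = P0 P (BSrc A f)"
    and BTgt_P1: "f \<in> Obj (B1 A) \<Longrightarrow> BTgt B (ObF (P1 P) f) = P0 P (BTgt A f)"
    and PUnit_cell:
      "a \<in> B0 A \<Longrightarrow>
        iso_arr (B1 B) (PUnit P a) \<and>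
        Dom (B1 B) (PUnit P a) = BId B (P0 P a) \<and>
        Cod (B1 B) (PUnit P a) = ObF (P1 P) (BId A a)"
    and PMult_cell:
      "(g, f) \<in> Obj (bcomp_pairs A) \<Longrightarrow>
        iso_arr (B1 B) (PMult P (g, f)) \<and>
        Dom (B1 B) (PMult P (g, f)) = ObF (P1 P) g \<star>\<^bsub>BComp B\<^esub> ObF (P1 P) f \<and>
        Cod (B1 B) (PMult P (g, f)) = ObF (P1 P) (g \<star>\<^bsub>BComp A\<^esub> f)"
    and PMult_natural:
      "(\<beta>, \<alpha>) \<in> Arr (bcomp_pairs A) \<Longrightarrow>
        PMult P (Cod (B1 A) \<beta>, Cod (B1 A) \<alpha>) \<cdot>\<^bsub>B1 B\<^esub> (ArF (P1 P) \<beta> \<odot>\<^bsub>BComp B\<^esub> ArF (P1 P) \<alpha>) =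
        ArF (P1 P) (\<beta> \<odot>\<^bsub>BComp A\<^esub> \<alpha>) \<cdot>\<^bsub>B1 B\<^esub> PMult P (Dom (B1 A) \<beta>, Dom (B1 A) \<alpha>)"
    and BAssoc_coherence:
      "\<lbrakk>(h, g) \<in> Obj (bcomp_pairs A); (g, f) \<in> Obj (bcomp_pairs A)\<rbrakk> \<Longrightarrow>
        ArF (P1 P) (BAssoc A h g f) \<cdot>\<^bsub>B1 B\<^esub> PMult P (h \<star>\<^bsub>BComp A\<^esub> g, f) \<cdot>\<^bsub>B1 B\<^esub>
          (PMult P (h, g) \<odot>\<^bsub>BComp B\<^esub> Id (B1 B) (ObF (P1 P) f)) =
        PMult P (h, g \<star>\<^bsub>BComp A\<^esub> f) \<cdot>\<^bsub>B1 B\<^esub>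
          (Id (B1 B) (ObF (P1 P) h) \<odot>\<^bsub>BComp B\<^esub> PMult P (g, f)) \<cdot>\<^bsub>B1 B\<^esub>
          BAssoc B (ObF (P1 P) h) (ObF (P1 P) g) (ObF (P1 P) f)"
    and BLUnit_coherence:
      "f \<in> Obj (B1 A) \<Longrightarrow>
        ArF (P1 P) (BLUnit A f) \<cdot>\<^bsub>B1 B\<^esub> PMult P (BId A (BTgt A f), f) \<cdot>\<^bsub>B1 B\<^esub>
          (PUnit P (BTgt A f) \<odot>\<^bsub>BComp B\<^esub> Id (B1 B) (ObF (P1 P) f)) =
        BLUnit B (ObF (P1 P) f)"
    and BRUnit_coherence:
      "f \<in> Obj (B1 A) \<Longrightarrow>
        ArF (P1 P) (BRUnit A f) \<cdot>\<^bsub>B1 B\<^esub> PMult P (f, BId A (BSrc A f)) \<cdot>\<^bsub>B1 B\<^esub>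
          (Id (B1 B) (ObF (P1 P) f) \<odot>\<^bsub>BComp B\<^esub> PUnit P (BSrc A f)) =
        BRUnit B (ObF (P1 P) f)"
    and pext: "P0 P \<in> extensional (B0 A)" "ext_functor (B1 A) (P1 P)"
      "PUnit P \<in> extensional (B0 A)" "PMult P \<in> extensional (Obj (bcomp_pairs A))"

definition id_psfun :: "('o, 'h, 's) bicat \<Rightarrow> ('o, 'h, 's, 'o, 'h, 's) psfun" where
  "id_psfun A =
    \<lparr>P0 = restrict id (B0 A), P1 = id_functor (B1 A),
     PUnit = restrict (\<lambda>a. Id (B1 A) (BId A a)) (B0 A),
     PMult = restrict (\<lambda>(g, f). Id (B1 A) (g \<star>\<^bsub>BComp A\<^esub> f)) (Obj (bcomp_pairs A))\<rparr>"

definition comp_psfun ::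
  "('o, 'h, 's) bicat \<Rightarrow> ('o3, 'h3, 's3) bicat \<Rightarrow> ('o2, 'h2, 's2, 'o3, 'h3, 's3) psfun
    \<Rightarrow> ('o, 'h, 's, 'o2, 'h2, 's2) psfun \<Rightarrow> ('o, 'h, 's, 'o3, 'h3, 's3) psfun" where
  "comp_psfun A E Q P =
    \<lparr>P0 = compose (B0 A) (P0 Q) (P0 P), P1 = comp_functor (B1 A) (P1 Q) (P1 P),
     PUnit = restrict (\<lambda>a. ArF (P1 Q) (PUnit P a) \<cdot>\<^bsub>B1 E\<^esub> PUnit Q (P0 P a)) (B0 A),
     PMult = restrict (\<lambda>(g, f). ArF (P1 Q) (PMult P (g, f)) \<cdot>\<^bsub>B1 E\<^esub>
       PMult Q (ObF (P1 P) g, ObF (P1 P) f)) (Obj (bcomp_pairs A))\<rparr>"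

record ('o, 'v, 'h, 's, 'o2, 'v2, 'h2, 's2) dec_psfun =
  Psf :: "('o, 'h, 's, 'o2, 'h2, 's2) psfun"
  DecF :: "('o, 'v, 'o2, 'v2) fctr"

locale decorated_pseudofunctor =
  A: decorated_bicategory A + B: decorated_bicategory B +
  Psf: pseudofunctor "Bic A" "Bic B" "Psf P" +
  DecF: cat_functor "Dec A" "Dec B" "DecF P"
  for A :: "('o, 'v, 'h, 's) dec_bicat" and B :: "('o2, 'v2, 'h2, 's2) dec_bicat"
    and P :: "('o, 'v, 'h, 's, 'o2, 'v2, 'h2, 's2) dec_psfun" +
  assumes ObF_DecF: "a \<in> B0 (Bic A) \<Longrightarrow> ObF (DecF P) a = P0 (Psf P) a"
    and ext_DecF: "ext_functor (Dec A) (DecF P)"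


section \<open>The categories of double categories and of decorated bicategories\<close>

text \<open>
  The underlying sets of all objects are drawn from the types \<open>'o\<close>, \<open>'v\<close>, \<open>'h\<close>, \<open>'s\<close>, which play
  the role of the universe. A morphism carries its domain and codomain.
\<close>

type_synonym ('o, 'v, 'h, 's) dbl_mor =
  "('o, 'v, 'h, 's) dbl_cat \<times> ('o, 'v, 'h, 's, 'o, 'v, 'h, 's) dbl_fun \<times> ('o, 'v, 'h, 's) dbl_cat"

definition dblCat :: "(('o, 'v, 'h, 's) dbl_cat, ('o, 'v, 'h, 's) dbl_mor) cat" where
  "dblCat =
    \<lparr>Obj = {C. double_category C},
     Arr = {(C, F, D). double_functor C D F},
     Dom = (\<lambda>(C, F, D). C),
     Cod = (\<lambda>(C, F, D). D),
     Id = (\<lambda>C. (C, id_dbl_fun C, C)),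
     Comp = (\<lambda>(_, G, E) (C, F, _). (C, comp_dbl_fun C E G F, E))\<rparr>"

definition gCat :: "(('o, 'v, 'h, 's) dbl_cat, ('o, 'v, 'h, 's) dbl_mor) cat" where
  "gCat = full_subcat dblCat {C. globularly_generated C}"

type_synonym ('o, 'v, 'h, 's) dec_mor =
  "('o, 'v, 'h, 's) dec_bicat \<times> ('o, 'v, 'h, 's, 'o, 'v, 'h, 's) dec_psfun \<times> ('o, 'v, 'h, 's) dec_bicat"

definition bCat_dec :: "(('o, 'v, 'h, 's) dec_bicat, ('o, 'v, 'h, 's) dec_mor) cat" where
  "bCat_dec =
    \<lparr>Obj = {A. decorated_bicategory A},
     Arr = {(A, P, B). decorated_pseudofunctor A B P},
     Dom = (\<lambda>(A, P, B). A),
     Cod = (\<lambda>(A, P, B). B),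
     Id = (\<lambda>A. (A, \<lparr>Psf = id_psfun (Bic A), DecF = id_functor (Dec A)\<rparr>, A)),
     Comp = (\<lambda>(_, Q, E) (A, P, _).
       (A, \<lparr>Psf = comp_psfun (Bic A) (Bic E) (Psf Q) (Psf P),
            DecF = comp_functor (Dec A) (DecF Q) (DecF P)\<rparr>, E))\<rparr>"


section \<open>Decorated horizontalization\<close>

definition HBic :: "('o, 'v, 'h, 's) dbl_cat \<Rightarrow> ('o, 'h, 's) bicat" where
  "HBic C =
    \<lparr>B0 = Obj (C0 C), B1 = (C1 C)\<lparr>Arr := globular C\<rparr>, BSrc = ObF (Src C), BTgt = ObF (Tgt C),
     BId = ObF (HId C), BComp = HComp C, BAssoc = Assoc C, BLUnit = LUnit C, BRUnit = RUnit C\<rparr>"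

definition Hstar_obj :: "('o, 'v, 'h, 's) dbl_cat \<Rightarrow> ('o, 'v, 'h, 's) dec_bicat" where
  "Hstar_obj C = \<lparr>Bic = HBic C, Dec = C0 C\<rparr>"

definition Hstar_fun :: "('o, 'v, 'h, 's) dbl_cat \<Rightarrow> ('o, 'v, 'h, 's, 'o2, 'v2, 'h2, 's2) dbl_fun
    \<Rightarrow> ('o, 'v, 'h, 's, 'o2, 'v2, 'h2, 's2) dec_psfun" where
  "Hstar_fun C F =
    \<lparr>Psf = \<lparr>P0 = ObF (F0 F), P1 = \<lparr>ObF = ObF (F1 F), ArF = restrict (ArF (F1 F)) (globular C)\<rparr>,
       PUnit = FUnit F, PMult = FMult F\<rparr>,
     DecF = F0 F\<rparr>"

definition Hstar ::
  "(('o, 'v, 'h, 's) dbl_cat, ('o, 'v, 'h, 's) dbl_mor,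
    ('o, 'v, 'h, 's) dec_bicat, ('o, 'v, 'h, 's) dec_mor) fctr" where
  "Hstar =
    \<lparr>ObF = Hstar_obj,
     ArF = (\<lambda>(C, F, D). (Hstar_obj C, Hstar_fun C F, Hstar_obj D))\<rparr>"

end

theory Submission
  imports Defs
begin

text \<open>
  A double functor \<open>F\<close> is determined on globular squares by \<open>H\<^sup>*F\<close>. On \<open>i\<^sub>v\<close> the naturality of the
  invertible unit cells \<open>\<eta>\<close> forces \<open>F i\<^sub>v = \<eta> \<cdot> i\<^sub>F\<^sub>v \<cdot> \<eta>\<^sup>-\<^sup>1\<close>, and likewise naturality of the invertible
  multiplication cells determines \<open>F (\<beta> \<odot> \<alpha>)\<close> from \<open>F \<beta>\<close> and \<open>F \<alpha>\<close>. By induction over generated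
  squares, \<open>H\<^sup>*F\<close> determines \<open>F\<close> when the domain is globularly generated. Double functors compose because
  their coherence axioms are those of the pseudofunctors between the horizontal bicategories.
\<close>

section \<open>Categories and functors\<close>

text \<open>Faithfulness is asserted of a functor between categories, so most of the work lies in
  showing that \<open>dblCat\<close> and \<open>bCat_dec\<close> are categories and that
  \<open>Hstar\<close> respects composition. The long coherence calculation is carried out once, for
  pseudofunctors, and transferred to double functors. What the transfer cannot supply is naturality
  of the unit and multiplication cells at vertical morphisms and squares that are not globular, so
  these two axioms are checked directly for identities and composites. The unit and associativity
  laws transfer as well: a double functor is given by its image under \<open>Hstar_fun\<close>
  together with \<open>F1\<close>. Equality of morphisms is equality of records, and it works
  because every component is \<open>undefined\<close> off its domain. \<open>Hstar\<close> is built
  on all of \<open>dblCat\<close>; globular generation enters in \<open>Hstar_fun_inj\<close>, where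
  it turns every square into a generated one.\<close>

text \<open>Composing with an inverse on the right undoes \<open>u\<close>. The cancelled arrow
  stands on the right because a naturality equation for a double functor \<open>F\<close> has the
  form \<open>F x\<close> after the cell at the domain; this uses the invertibility of the cells
  without naming their inverses.\<close>

lemma (in category) iso_arr_cancel:
  assumes "iso_arr A u" "f \<in> Arr A" "g \<in> Arr A" "Dom A f = Cod A u" "Dom A g = Cod A u"
    and "f \<cdot>\<^bsub>A\<^esub> u = g \<cdot>\<^bsub>A\<^esub> u"
  shows "f = g"
proof -
  from assms(1) obtain w where w: "u \<in> Arr A" "w \<in> Arr A" "Dom A w = Cod A u" "Cod A w = Dom A u"
      "u \<cdot>\<^bsub>A\<^esub> w = Id A (Cod A u)"
    unfolding iso_arr_def by blast
  have "f = (f \<cdot>\<^bsub>A\<^esub> u) \<cdot>\<^bsub>A\<^esub> w"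
    using w assms by (metis Comp_assoc Comp_Id)
  also have "\<dots> = g"
    using w assms by (metis Comp_assoc Comp_Id)
  finally show ?thesis .
qed

text \<open>The domain is a separate variable, so the rule still matches once \<open>Dom A f\<close>
  has been rewritten to another form.\<close>

lemma (in category) Comp_Id': "\<lbrakk>f \<in> Arr A; Dom A f = a\<rbrakk> \<Longrightarrow> f \<cdot>\<^bsub>A\<^esub> Id A a = f"
  using Comp_Id by blast

lemma (in category) Id_Comp': "\<lbrakk>f \<in> Arr A; Cod A f = a\<rbrakk> \<Longrightarrow> Id A a \<cdot>\<^bsub>A\<^esub> f = f"
  using Id_Comp by blast

lemma (in category) iso_arr_Id: "a \<in> Obj A \<Longrightarrow> iso_arr A (Id A a)"
  unfolding iso_arr_def by (metis Id_Arr Dom_Id Cod_Id Comp_Id)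

lemma (in category) iso_arr_Comp:
  assumes "iso_arr A f" "iso_arr A g" "Dom A g = Cod A f"
  shows "iso_arr A (g \<cdot>\<^bsub>A\<^esub> f)"
proof -
  from assms obtain f' g' where
    f: "f \<in> Arr A" "f' \<in> Arr A" "Dom A f' = Cod A f" "Cod A f' = Dom A f"
      "f' \<cdot>\<^bsub>A\<^esub> f = Id A (Dom A f)" "f \<cdot>\<^bsub>A\<^esub> f' = Id A (Cod A f)" and
    g: "g \<in> Arr A" "g' \<in> Arr A" "Dom A g' = Cod A g" "Cod A g' = Dom A g"
      "g' \<cdot>\<^bsub>A\<^esub> g = Id A (Dom A g)" "g \<cdot>\<^bsub>A\<^esub> g' = Id A (Cod A g)"
    unfolding iso_arr_def by blast
  have "(f' \<cdot>\<^bsub>A\<^esub> g') \<cdot>\<^bsub>A\<^esub> (g \<cdot>\<^bsub>A\<^esub> f) = f' \<cdot>\<^bsub>A\<^esub> ((g' \<cdot>\<^bsub>A\<^esub> g) \<cdot>\<^bsub>A\<^esub> f)"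
    using f(1-4) g(1-4) assms(3) by (simp add: Comp_assoc Comp_Arr Dom_Comp Cod_Comp)
  also have "\<dots> = Id A (Dom A f)"
    using f g assms(3) by (metis Id_Comp)
  finally have 1: "(f' \<cdot>\<^bsub>A\<^esub> g') \<cdot>\<^bsub>A\<^esub> (g \<cdot>\<^bsub>A\<^esub> f) = Id A (Dom A f)" .
  have "(g \<cdot>\<^bsub>A\<^esub> f) \<cdot>\<^bsub>A\<^esub> (f' \<cdot>\<^bsub>A\<^esub> g') = g \<cdot>\<^bsub>A\<^esub> ((f \<cdot>\<^bsub>A\<^esub> f') \<cdot>\<^bsub>A\<^esub> g')"
    using f(1-4) g(1-4) assms(3) by (simp add: Comp_assoc Comp_Arr Dom_Comp Cod_Comp)
  also have "\<dots> = Id A (Cod A g)"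
    using f g assms(3) by (metis Id_Comp)
  finally have 2: "(g \<cdot>\<^bsub>A\<^esub> f) \<cdot>\<^bsub>A\<^esub> (f' \<cdot>\<^bsub>A\<^esub> g') = Id A (Cod A g)" .
  show ?thesis
    unfolding iso_arr_def using f g assms(3) 1 2
    by (intro conjI bexI[of _ "f' \<cdot>\<^bsub>A\<^esub> g'"]) (simp_all add: Comp_Arr Dom_Comp Cod_Comp)
qed

lemma (in cat_functor) iso_arr_ArF:
  assumes "iso_arr A f"
  shows "iso_arr B (ArF F f)"
proof -
  from assms obtain g where g: "f \<in> Arr A" "g \<in> Arr A" "Dom A g = Cod A f" "Cod A g = Dom A f"
      "g \<cdot>\<^bsub>A\<^esub> f = Id A (Dom A f)" "f \<cdot>\<^bsub>A\<^esub> g = Id A (Cod A f)"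
    unfolding iso_arr_def by blast
  then have "ArF F g \<cdot>\<^bsub>B\<^esub> ArF F f = Id B (ObF F (Dom A f))"
      "ArF F f \<cdot>\<^bsub>B\<^esub> ArF F g = Id B (ObF F (Cod A f))"
    by (metis ArF_Comp ArF_Id A.Dom_Obj A.Cod_Obj)+
  with g show ?thesis
    unfolding iso_arr_def by (intro conjI bexI[of _ "ArF F g"]) (simp_all add: ArF_Arr Dom_ArF Cod_ArF)
qed

section \<open>Identity and composite functors as normalised records\<close>

lemma cat_functor_id: "category A \<Longrightarrow> cat_functor A A (id_functor A)"
  by (simp add: cat_functor_def cat_functor_axioms_def category.Dom_Obj category.Cod_Obj
      category.Id_Arr category.Comp_Arr id_functor_def)

lemma cat_functor_comp:
  assumes "cat_functor A B F" "cat_functor B C G"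
  shows "cat_functor A C (comp_functor A G F)"
proof -
  interpret F: cat_functor A B F by fact
  interpret G: cat_functor B C G by fact
  show ?thesis
    by unfold_locales (simp_all add: comp_functor_def compose_def F.ObF_Obj F.ArF_Arr G.ObF_Obj
        G.ArF_Arr F.Dom_ArF F.Cod_ArF G.Dom_ArF G.Cod_ArF F.A.Dom_Obj F.A.Cod_Obj F.A.Id_Arr
        F.A.Comp_Arr F.ArF_Id G.ArF_Id F.ArF_Comp G.ArF_Comp)
qed

lemma ext_functor_id: "ext_functor A (id_functor A)"
  by (simp add: ext_functor_def id_functor_def)

lemma ext_functor_comp: "ext_functor A (comp_functor A G F)"
  by (simp add: ext_functor_def comp_functor_def)

lemma comp_functor_assoc:
  assumes "cat_functor A B F"
  shows "comp_functor A (comp_functor B H G) F = comp_functor A H (comp_functor A G F)"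
proof -
  interpret F: cat_functor A B F by fact
  show ?thesis
    by (auto simp: comp_functor_def compose_def fun_eq_iff F.ObF_Obj F.ArF_Arr)
qed

text \<open>On \<open>A\<close> the values of \<open>F\<close> lie in \<open>B\<close>, where the
  restricted identity acts as the identity; off \<open>A\<close> both sides are
  \<open>undefined\<close>, the right one by \<open>ext_functor\<close>.\<close>

lemma comp_functor_id_left:
  assumes "cat_functor A B F" "ext_functor A F"
  shows "comp_functor A (id_functor B) F = F"
proof -
  interpret F: cat_functor A B F by fact
  show ?thesis
    using assms(2)
    by (cases F) (auto simp: comp_functor_def id_functor_def compose_def fun_eq_iff ext_functor_def
        extensional_def dest: F.ObF_Obj F.ArF_Arr)
qed

lemma comp_functor_id_right:
  assumes "ext_functor A F"
  shows "comp_functor A F (id_functor A) = F"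
  using assms
  by (cases F) (auto simp: comp_functor_def id_functor_def compose_def fun_eq_iff ext_functor_def
        extensional_def)

lemma category_full_subcat:
  assumes "category A"
  shows "category (full_subcat A X)"
proof -
  interpret category A by fact
  show ?thesis
    by unfold_locales (auto simp: full_subcat_def Dom_Obj Cod_Obj Id_Arr Dom_Id Cod_Id Comp_Arr
        Dom_Comp Cod_Comp Comp_Id Id_Comp Comp_assoc)
qed

section \<open>Bicategories and pseudofunctors\<close>

context bicategory
begin

text \<open>A discrete functor reads off the 0-cell of a 2-cell at its domain, so composability of
  2-cells is a condition on domains. The same condition at codomains follows from
  \<open>BSrc_2cell\<close> and \<open>BTgt_2cell\<close>.\<close>

lemma bcomp_pairs_simps:
  "(g, f) \<in> Obj (bcomp_pairs B) \<longleftrightarrow> g \<in> Obj (B1 B) \<and> f \<in> Obj (B1 B) \<and> BSrc B g = BTgt B f"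
  "(\<beta>, \<alpha>) \<in> Arr (bcomp_pairs B) \<longleftrightarrow> \<beta> \<in> Arr (B1 B) \<and> \<alpha> \<in> Arr (B1 B) \<and>
     BSrc B (Dom (B1 B) \<beta>) = BTgt B (Dom (B1 B) \<alpha>)"
  "Dom (bcomp_pairs B) (\<beta>, \<alpha>) = (Dom (B1 B) \<beta>, Dom (B1 B) \<alpha>)"
  "Cod (bcomp_pairs B) (\<beta>, \<alpha>) = (Cod (B1 B) \<beta>, Cod (B1 B) \<alpha>)"
  "Id (bcomp_pairs B) (g, f) = (Id (B1 B) g, Id (B1 B) f)"
  "(\<beta>', \<alpha>') \<cdot>\<^bsub>bcomp_pairs B\<^esub> (\<beta>, \<alpha>) = (\<beta>' \<cdot>\<^bsub>B1 B\<^esub> \<beta>, \<alpha>' \<cdot>\<^bsub>B1 B\<^esub> \<alpha>)"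
  by (simp_all add: bcomp_pairs_def fiber_product_def discrete_fctr_def)

lemma hcomp1_Obj:
  "\<lbrakk>g \<in> Obj (B1 B); f \<in> Obj (B1 B); BSrc B g = BTgt B f\<rbrakk> \<Longrightarrow> g \<star>\<^bsub>BComp B\<^esub> f \<in> Obj (B1 B)"
  "\<lbrakk>g \<in> Obj (B1 B); f \<in> Obj (B1 B); BSrc B g = BTgt B f\<rbrakk> \<Longrightarrow> BSrc B (g \<star>\<^bsub>BComp B\<^esub> f) = BSrc B f"
  "\<lbrakk>g \<in> Obj (B1 B); f \<in> Obj (B1 B); BSrc B g = BTgt B f\<rbrakk> \<Longrightarrow> BTgt B (g \<star>\<^bsub>BComp B\<^esub> f) = BTgt B g"
  using BComp.ObF_Obj[of "(g, f)"] BSrc_BComp[of g f] BTgt_BComp[of g f]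
  by (simp_all add: bcomp_pairs_simps)

lemma hcomp2_Arr:
  assumes "\<beta> \<in> Arr (B1 B)" "\<alpha> \<in> Arr (B1 B)" "BSrc B (Dom (B1 B) \<beta>) = BTgt B (Dom (B1 B) \<alpha>)"
  shows "\<beta> \<odot>\<^bsub>BComp B\<^esub> \<alpha> \<in> Arr (B1 B)"
    and "Dom (B1 B) (\<beta> \<odot>\<^bsub>BComp B\<^esub> \<alpha>) = Dom (B1 B) \<beta> \<star>\<^bsub>BComp B\<^esub> Dom (B1 B) \<alpha>"
    and "Cod (B1 B) (\<beta> \<odot>\<^bsub>BComp B\<^esub> \<alpha>) = Cod (B1 B) \<beta> \<star>\<^bsub>BComp B\<^esub> Cod (B1 B) \<alpha>"
  using assms BComp.ArF_Arr[of "(\<beta>, \<alpha>)"] BComp.Dom_ArF[of "(\<beta>, \<alpha>)"] BComp.Cod_ArF[of "(\<beta>, \<alpha>)"]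
  by (simp_all add: bcomp_pairs_simps)

lemma hcomp2_Id:
  "\<lbrakk>g \<in> Obj (B1 B); f \<in> Obj (B1 B); BSrc B g = BTgt B f\<rbrakk> \<Longrightarrow>
     Id (B1 B) g \<odot>\<^bsub>BComp B\<^esub> Id (B1 B) f = Id (B1 B) (g \<star>\<^bsub>BComp B\<^esub> f)"
  using BComp.ArF_Id[of "(g, f)"] by (simp add: bcomp_pairs_simps)

lemma interchange:
  assumes "\<beta> \<in> Arr (B1 B)" "\<alpha> \<in> Arr (B1 B)" "\<beta>' \<in> Arr (B1 B)" "\<alpha>' \<in> Arr (B1 B)"
    and "Dom (B1 B) \<beta>' = Cod (B1 B) \<beta>" "Dom (B1 B) \<alpha>' = Cod (B1 B) \<alpha>"
    and "BSrc B (Dom (B1 B) \<beta>) = BTgt B (Dom (B1 B) \<alpha>)"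
  shows "(\<beta>' \<cdot>\<^bsub>B1 B\<^esub> \<beta>) \<odot>\<^bsub>BComp B\<^esub> (\<alpha>' \<cdot>\<^bsub>B1 B\<^esub> \<alpha>) =
    (\<beta>' \<odot>\<^bsub>BComp B\<^esub> \<alpha>') \<cdot>\<^bsub>B1 B\<^esub> (\<beta> \<odot>\<^bsub>BComp B\<^esub> \<alpha>)"
proof -
  \<comment> \<open>Composability passes from the first row to the second because 2-cells keep the
    source and target 0-cells fixed.\<close>
  have "BSrc B (Dom (B1 B) \<beta>') = BTgt B (Dom (B1 B) \<alpha>')"
    using assms by (simp add: BSrc_2cell BTgt_2cell)
  then show ?thesis
    using assms BComp.ArF_Comp[of "(\<beta>, \<alpha>)" "(\<beta>', \<alpha>')"] by (simp add: bcomp_pairs_simps)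
qed

text \<open>Interchange, with the identity of \<open>f\<close> written as its own composite with
  itself.\<close>

lemma whisker_right:
  assumes "\<beta> \<in> Arr (B1 B)" "\<beta>' \<in> Arr (B1 B)" "Dom (B1 B) \<beta>' = Cod (B1 B) \<beta>"
    and "f \<in> Obj (B1 B)" "BSrc B (Dom (B1 B) \<beta>) = BTgt B f"
  shows "(\<beta>' \<cdot>\<^bsub>B1 B\<^esub> \<beta>) \<odot>\<^bsub>BComp B\<^esub> Id (B1 B) f =
    (\<beta>' \<odot>\<^bsub>BComp B\<^esub> Id (B1 B) f) \<cdot>\<^bsub>B1 B\<^esub> (\<beta> \<odot>\<^bsub>BComp B\<^esub> Id (B1 B) f)"
  using assms interchange[of \<beta> "Id (B1 B) f" \<beta>' "Id (B1 B) f"] B1.Comp_Id[of "Id (B1 B) f"]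
  by (simp add: B1.Id_Arr B1.Dom_Id B1.Cod_Id)

lemma whisker_left:
  assumes "\<alpha> \<in> Arr (B1 B)" "\<alpha>' \<in> Arr (B1 B)" "Dom (B1 B) \<alpha>' = Cod (B1 B) \<alpha>"
    and "g \<in> Obj (B1 B)" "BSrc B g = BTgt B (Dom (B1 B) \<alpha>)"
  shows "Id (B1 B) g \<odot>\<^bsub>BComp B\<^esub> (\<alpha>' \<cdot>\<^bsub>B1 B\<^esub> \<alpha>) =
    (Id (B1 B) g \<odot>\<^bsub>BComp B\<^esub> \<alpha>') \<cdot>\<^bsub>B1 B\<^esub> (Id (B1 B) g \<odot>\<^bsub>BComp B\<^esub> \<alpha>)"
  using assms interchange[of "Id (B1 B) g" \<alpha> "Id (B1 B) g" \<alpha>'] B1.Comp_Id[of "Id (B1 B) g"]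
  by (simp add: B1.Id_Arr B1.Dom_Id B1.Cod_Id)

lemma structure_cells:
  "\<lbrakk>h \<in> Obj (B1 B); g \<in> Obj (B1 B); f \<in> Obj (B1 B); BSrc B h = BTgt B g; BSrc B g = BTgt B f\<rbrakk> \<Longrightarrow>
     BAssoc B h g f \<in> Arr (B1 B)"
  "\<lbrakk>h \<in> Obj (B1 B); g \<in> Obj (B1 B); f \<in> Obj (B1 B); BSrc B h = BTgt B g; BSrc B g = BTgt B f\<rbrakk> \<Longrightarrow>
     Dom (B1 B) (BAssoc B h g f) = (h \<star>\<^bsub>BComp B\<^esub> g) \<star>\<^bsub>BComp B\<^esub> f"
  "\<lbrakk>h \<in> Obj (B1 B); g \<in> Obj (B1 B); f \<in> Obj (B1 B); BSrc B h = BTgt B g; BSrc B g = BTgt B f\<rbrakk> \<Longrightarrow>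
     Cod (B1 B) (BAssoc B h g f) = h \<star>\<^bsub>BComp B\<^esub> (g \<star>\<^bsub>BComp B\<^esub> f)"
  "f \<in> Obj (B1 B) \<Longrightarrow> BLUnit B f \<in> Arr (B1 B)"
  "f \<in> Obj (B1 B) \<Longrightarrow> Dom (B1 B) (BLUnit B f) = BId B (BTgt B f) \<star>\<^bsub>BComp B\<^esub> f"
  "f \<in> Obj (B1 B) \<Longrightarrow> Cod (B1 B) (BLUnit B f) = f"
  "f \<in> Obj (B1 B) \<Longrightarrow> BRUnit B f \<in> Arr (B1 B)"
  "f \<in> Obj (B1 B) \<Longrightarrow> Dom (B1 B) (BRUnit B f) = f \<star>\<^bsub>BComp B\<^esub> BId B (BSrc B f)"
  "f \<in> Obj (B1 B) \<Longrightarrow> Cod (B1 B) (BRUnit B f) = f"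
  using BAssoc_cell[of h g f] BLUnit_cell[of f] BRUnit_cell[of f]
  by (simp_all add: bcomp_pairs_simps iso_arr_def)

text \<open>The typing rules that settle the composability conditions arising in the coherence
  calculations.\<close>

lemmas cell_simps = B1.Dom_Obj B1.Cod_Obj B1.Id_Arr B1.Dom_Id B1.Cod_Id B1.Comp_Arr B1.Dom_Comp
  B1.Cod_Comp BSrc_B0 BTgt_B0 BSrc_2cell BTgt_2cell BId_Obj BSrc_BId BTgt_BId hcomp1_Obj hcomp2_Arr
  structure_cells

end

context pseudofunctor
begin

lemma P_cells:
  "\<lbrakk>g \<in> Obj (B1 A); f \<in> Obj (B1 A); BSrc A g = BTgt A f\<rbrakk> \<Longrightarrow> PMult P (g, f) \<in> Arr (B1 B)"
  "\<lbrakk>g \<in> Obj (B1 A); f \<in> Obj (B1 A); BSrc A g = BTgt A f\<rbrakk> \<Longrightarrow>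
    Dom (B1 B) (PMult P (g, f)) = ObF (P1 P) g \<star>\<^bsub>BComp B\<^esub> ObF (P1 P) f"
  "\<lbrakk>g \<in> Obj (B1 A); f \<in> Obj (B1 A); BSrc A g = BTgt A f\<rbrakk> \<Longrightarrow>
    Cod (B1 B) (PMult P (g, f)) = ObF (P1 P) (g \<star>\<^bsub>BComp A\<^esub> f)"
  "a \<in> B0 A \<Longrightarrow> PUnit P a \<in> Arr (B1 B)"
  "a \<in> B0 A \<Longrightarrow> Dom (B1 B) (PUnit P a) = BId B (P0 P a)"
  "a \<in> B0 A \<Longrightarrow> Cod (B1 B) (PUnit P a) = ObF (P1 P) (BId A a)"
  using PMult_cell[of g f] PUnit_cell[of a] by (simp_all add: A.bcomp_pairs_simps iso_arr_def)

lemmas functor_simps = P1.ObF_Obj P1.ArF_Arr P1.Dom_ArF P1.Cod_ArF P1.ArF_Id P0_B0 BSrc_P1 BTgt_P1 P_cells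

end

section \<open>Identity and composite pseudofunctors\<close>

lemma pseudofunctor_id:
  assumes "bicategory A"
  shows "pseudofunctor A A (id_psfun A)"
proof -
  interpret bicategory A by fact
  interpret P1: cat_functor "B1 A" "B1 A" "P1 (id_psfun A)"
    by (simp add: id_psfun_def cat_functor_id B1.category_axioms)
  show ?thesis
    by unfold_locales
      (simp_all add: id_psfun_def id_functor_def ext_functor_def bcomp_pairs_simps cell_simps
        B1.iso_arr_Id hcomp2_Id B1.Comp_Id' B1.Id_Comp')
qed

text \<open>Each coherence axiom is a pasting: the multiplication of \<open>Q\<close> is moved past
  the image of a structure cell of \<open>P\<close>, the axiom for \<open>P\<close> is applied under
  \<open>P1 Q\<close>, and the axiom for \<open>Q\<close> disposes of the rest.\<close>

lemma pseudofunctor_comp: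
  assumes "pseudofunctor A B P" "pseudofunctor B E Q"
  shows "pseudofunctor A E (comp_psfun A E Q P)"
proof -
  interpret P: pseudofunctor A B P by fact
  interpret Q: pseudofunctor B E Q by fact
  let ?R = "comp_psfun A E Q P"
  interpret R1: cat_functor "B1 A" "B1 E" "P1 ?R"
    using cat_functor_comp[OF P.P1.cat_functor_axioms Q.P1.cat_functor_axioms]
    by (simp add: comp_psfun_def)
  note [simp] = P.A.cell_simps P.B.cell_simps Q.B.cell_simps P.functor_simps Q.functor_simps
    P.A.bcomp_pairs_simps P.B.bcomp_pairs_simps Q.B.bcomp_pairs_simps
  \<comment> \<open>Cases 7 to 9 use this with a structure cell of \<open>P\<close> beside an
    identity; it then exchanges the multiplication of \<open>Q\<close> with the image of that
    cell.\<close>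
  have Q_mult: "PMult Q (Cod (B1 B) \<beta>, Cod (B1 B) \<alpha>) \<cdot>\<^bsub>B1 E\<^esub> (ArF (P1 Q) \<beta> \<odot>\<^bsub>BComp E\<^esub> ArF (P1 Q) \<alpha>)
      = ArF (P1 Q) (\<beta> \<odot>\<^bsub>BComp B\<^esub> \<alpha>) \<cdot>\<^bsub>B1 E\<^esub> PMult Q (Dom (B1 B) \<beta>, Dom (B1 B) \<alpha>)"
    if "\<beta> \<in> Arr (B1 B)" "\<alpha> \<in> Arr (B1 B)" "BSrc B (Dom (B1 B) \<beta>) = BTgt B (Dom (B1 B) \<alpha>)" for \<beta> \<alpha>
    using Q.PMult_natural[of \<beta> \<alpha>] that by simp
  show ?thesis
  proof (unfold_locales, goal_cases)
    case (4 a) then show ?case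
      by (simp add: comp_psfun_def comp_functor_def compose_def Q.B.B1.iso_arr_Comp
          P.PUnit_cell Q.PUnit_cell Q.P1.iso_arr_ArF)
  next
    case (5 g f) then show ?case
      using P.PMult_cell[of g f] Q.PMult_cell[of "ObF (P1 P) g" "ObF (P1 P) f"]
      by (simp add: comp_psfun_def comp_functor_def compose_def Q.B.B1.iso_arr_Comp Q.P1.iso_arr_ArF)
  next
    case (6 \<beta> \<alpha>)
    then have ty: "\<beta> \<in> Arr (B1 A)" "\<alpha> \<in> Arr (B1 A)" "BSrc A (Dom (B1 A) \<beta>) = BTgt A (Dom (B1 A) \<alpha>)"
      by simp_all
    have "ArF (P1 Q) (PMult P (Cod (B1 A) \<beta>, Cod (B1 A) \<alpha>)) \<cdot>\<^bsub>B1 E\<^esub>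
          PMult Q (ObF (P1 P) (Cod (B1 A) \<beta>), ObF (P1 P) (Cod (B1 A) \<alpha>)) \<cdot>\<^bsub>B1 E\<^esub>
          (ArF (P1 Q) (ArF (P1 P) \<beta>) \<odot>\<^bsub>BComp E\<^esub> ArF (P1 Q) (ArF (P1 P) \<alpha>)) =
        ArF (P1 Q) (PMult P (Cod (B1 A) \<beta>, Cod (B1 A) \<alpha>) \<cdot>\<^bsub>B1 B\<^esub>
          (ArF (P1 P) \<beta> \<odot>\<^bsub>BComp B\<^esub> ArF (P1 P) \<alpha>)) \<cdot>\<^bsub>B1 E\<^esub>
        PMult Q (ObF (P1 P) (Dom (B1 A) \<beta>), ObF (P1 P) (Dom (B1 A) \<alpha>))"
      using ty Q_mult[of "ArF (P1 P) \<beta>" "ArF (P1 P) \<alpha>"]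
      by (simp add: Q.P1.ArF_Comp Q.B.B1.Comp_assoc)
    also have "\<dots> = ArF (P1 Q) (ArF (P1 P) (\<beta> \<odot>\<^bsub>BComp A\<^esub> \<alpha>)) \<cdot>\<^bsub>B1 E\<^esub>
        ArF (P1 Q) (PMult P (Dom (B1 A) \<beta>, Dom (B1 A) \<alpha>)) \<cdot>\<^bsub>B1 E\<^esub>
        PMult Q (ObF (P1 P) (Dom (B1 A) \<beta>), ObF (P1 P) (Dom (B1 A) \<alpha>))"
      using ty P.PMult_natural[of \<beta> \<alpha>]
      by (simp add: Q.P1.ArF_Comp Q.B.B1.Comp_assoc)
    finally show ?case
      using ty by (simp add: comp_psfun_def comp_functor_def compose_def Q.B.B1.Comp_assoc)
  next
    case (7 h g f)
    then have ty: "h \<in> Obj (B1 A)" "g \<in> Obj (B1 A)" "f \<in> Obj (B1 A)"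
        "BSrc A h = BTgt A g" "BSrc A g = BTgt A f"
      by simp_all
    define h' g' f' h'' g'' f'' where d: "h' = ObF (P1 P) h" "g' = ObF (P1 P) g" "f' = ObF (P1 P) f"
      "h'' = ObF (P1 Q) h'" "g'' = ObF (P1 Q) g'" "f'' = ObF (P1 Q) f'"
    have ty': "h' \<in> Obj (B1 B)" "g' \<in> Obj (B1 B)" "f' \<in> Obj (B1 B)"
        "BSrc B h' = BTgt B g'" "BSrc B g' = BTgt B f'"
      using ty by (simp_all add: d)
    note assoc = Q.B.B1.Comp_assoc
    have l: "PMult Q (ObF (P1 P) (h \<star>\<^bsub>BComp A\<^esub> g), f') \<cdot>\<^bsub>B1 E\<^esub>
         (ArF (P1 Q) (PMult P (h, g)) \<odot>\<^bsub>BComp E\<^esub> Id (B1 E) f'') =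
        ArF (P1 Q) (PMult P (h, g) \<odot>\<^bsub>BComp B\<^esub> Id (B1 B) f') \<cdot>\<^bsub>B1 E\<^esub> PMult Q (h' \<star>\<^bsub>BComp B\<^esub> g', f')"
      using ty Q_mult[of "PMult P (h, g)" "Id (B1 B) f'"] by (simp add: d)
    have r: "PMult Q (h', ObF (P1 P) (g \<star>\<^bsub>BComp A\<^esub> f)) \<cdot>\<^bsub>B1 E\<^esub>
         (Id (B1 E) h'' \<odot>\<^bsub>BComp E\<^esub> ArF (P1 Q) (PMult P (g, f))) =
        ArF (P1 Q) (Id (B1 B) h' \<odot>\<^bsub>BComp B\<^esub> PMult P (g, f)) \<cdot>\<^bsub>B1 E\<^esub> PMult Q (h', g' \<star>\<^bsub>BComp B\<^esub> f')"
      using ty Q_mult[of "Id (B1 B) h'" "PMult P (g, f)"] by (simp add: d)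
    have "ArF (P1 Q) (ArF (P1 P) (BAssoc A h g f)) \<cdot>\<^bsub>B1 E\<^esub>
        (ArF (P1 Q) (PMult P (h \<star>\<^bsub>BComp A\<^esub> g, f)) \<cdot>\<^bsub>B1 E\<^esub> PMult Q (ObF (P1 P) (h \<star>\<^bsub>BComp A\<^esub> g), f')) \<cdot>\<^bsub>B1 E\<^esub>
        ((ArF (P1 Q) (PMult P (h, g)) \<cdot>\<^bsub>B1 E\<^esub> PMult Q (h', g')) \<odot>\<^bsub>BComp E\<^esub> Id (B1 E) f'') =
      ArF (P1 Q) (ArF (P1 P) (BAssoc A h g f)) \<cdot>\<^bsub>B1 E\<^esub>
        ArF (P1 Q) (PMult P (h \<star>\<^bsub>BComp A\<^esub> g, f)) \<cdot>\<^bsub>B1 E\<^esub>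
        (PMult Q (ObF (P1 P) (h \<star>\<^bsub>BComp A\<^esub> g), f') \<cdot>\<^bsub>B1 E\<^esub>
         (ArF (P1 Q) (PMult P (h, g)) \<odot>\<^bsub>BComp E\<^esub> Id (B1 E) f'')) \<cdot>\<^bsub>B1 E\<^esub>
         (PMult Q (h', g') \<odot>\<^bsub>BComp E\<^esub> Id (B1 E) f'')"
      using ty by (simp add: d assoc Q.B.whisker_right)
    also have "\<dots> = ArF (P1 Q) (ArF (P1 P) (BAssoc A h g f) \<cdot>\<^bsub>B1 B\<^esub> PMult P (h \<star>\<^bsub>BComp A\<^esub> g, f) \<cdot>\<^bsub>B1 B\<^esub>
        (PMult P (h, g) \<odot>\<^bsub>BComp B\<^esub> Id (B1 B) f')) \<cdot>\<^bsub>B1 E\<^esub>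
        PMult Q (h' \<star>\<^bsub>BComp B\<^esub> g', f') \<cdot>\<^bsub>B1 E\<^esub> (PMult Q (h', g') \<odot>\<^bsub>BComp E\<^esub> Id (B1 E) f'')"
      unfolding l using ty by (simp add: d assoc Q.P1.ArF_Comp)
    \<comment> \<open>Associativity for \<open>P\<close> rewrites only the subterm under
      \<open>P1 Q\<close>; the step after it takes up the whole expression again and distributes
      \<open>P1 Q\<close> over the result.\<close>
    also have "ArF (P1 P) (BAssoc A h g f) \<cdot>\<^bsub>B1 B\<^esub> PMult P (h \<star>\<^bsub>BComp A\<^esub> g, f) \<cdot>\<^bsub>B1 B\<^esub>
        (PMult P (h, g) \<odot>\<^bsub>BComp B\<^esub> Id (B1 B) f') = PMult P (h, g \<star>\<^bsub>BComp A\<^esub> f) \<cdot>\<^bsub>B1 B\<^esub>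
          (Id (B1 B) h' \<odot>\<^bsub>BComp B\<^esub> PMult P (g, f)) \<cdot>\<^bsub>B1 B\<^esub> BAssoc B h' g' f'"
      using P.BAssoc_coherence[of h g f] ty by (simp add: d)
    also have "ArF (P1 Q) \<dots> \<cdot>\<^bsub>B1 E\<^esub>
        PMult Q (h' \<star>\<^bsub>BComp B\<^esub> g', f') \<cdot>\<^bsub>B1 E\<^esub> (PMult Q (h', g') \<odot>\<^bsub>BComp E\<^esub> Id (B1 E) f'') =
      ArF (P1 Q) (PMult P (h, g \<star>\<^bsub>BComp A\<^esub> f)) \<cdot>\<^bsub>B1 E\<^esub>
        ArF (P1 Q) (Id (B1 B) h' \<odot>\<^bsub>BComp B\<^esub> PMult P (g, f)) \<cdot>\<^bsub>B1 E\<^esub>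
        (ArF (P1 Q) (BAssoc B h' g' f') \<cdot>\<^bsub>B1 E\<^esub>
        PMult Q (h' \<star>\<^bsub>BComp B\<^esub> g', f') \<cdot>\<^bsub>B1 E\<^esub> (PMult Q (h', g') \<odot>\<^bsub>BComp E\<^esub> Id (B1 E) f''))"
      using ty by (simp add: d assoc Q.P1.ArF_Comp)
    also have "\<dots> = ArF (P1 Q) (PMult P (h, g \<star>\<^bsub>BComp A\<^esub> f)) \<cdot>\<^bsub>B1 E\<^esub>
        (ArF (P1 Q) (Id (B1 B) h' \<odot>\<^bsub>BComp B\<^esub> PMult P (g, f)) \<cdot>\<^bsub>B1 E\<^esub>
        PMult Q (h', g' \<star>\<^bsub>BComp B\<^esub> f')) \<cdot>\<^bsub>B1 E\<^esub> (Id (B1 E) h'' \<odot>\<^bsub>BComp E\<^esub> PMult Q (g', f')) \<cdot>\<^bsub>B1 E\<^esub>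
        BAssoc E h'' g'' f''"
      using Q.BAssoc_coherence[of h' g' f'] ty by (simp add: d assoc)
    \<comment> \<open>Read backwards, \<open>r\<close> brings the multiplication of \<open>Q\<close>
      in front of the image of \<open>PMult P (g, f)\<close>; the factors then regroup into
      multiplications of the composite.\<close>
    also have "\<dots> = (ArF (P1 Q) (PMult P (h, g \<star>\<^bsub>BComp A\<^esub> f)) \<cdot>\<^bsub>B1 E\<^esub>
        PMult Q (h', ObF (P1 P) (g \<star>\<^bsub>BComp A\<^esub> f))) \<cdot>\<^bsub>B1 E\<^esub>
        (Id (B1 E) h'' \<odot>\<^bsub>BComp E\<^esub> (ArF (P1 Q) (PMult P (g, f)) \<cdot>\<^bsub>B1 E\<^esub> PMult Q (g', f'))) \<cdot>\<^bsub>B1 E\<^esub>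
        BAssoc E h'' g'' f''"
      unfolding r[symmetric] using ty by (simp add: d assoc Q.B.whisker_left)
    finally show ?case
      using ty by (simp add: comp_psfun_def comp_functor_def compose_def d)
  next
    case (8 f)
    define t f' t' where d: "t = BTgt A f" "f' = ObF (P1 P) f" "t' = P0 P t"
    have ty: "f \<in> Obj (B1 A)" "t \<in> B0 A"
      using 8 by (simp_all add: d)
    note assoc = Q.B.B1.Comp_assoc
    \<comment> \<open>The pattern of associativity with the unit cell of \<open>P\<close> in the
      place of a multiplication cell.\<close>
    have l: "PMult Q (ObF (P1 P) (BId A t), f') \<cdot>\<^bsub>B1 E\<^esub>
         (ArF (P1 Q) (PUnit P t) \<odot>\<^bsub>BComp E\<^esub> Id (B1 E) (ObF (P1 Q) f')) =
        ArF (P1 Q) (PUnit P t \<odot>\<^bsub>BComp B\<^esub> Id (B1 B) f') \<cdot>\<^bsub>B1 E\<^esub> PMult Q (BId B t', f')"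
      using ty Q_mult[of "PUnit P t" "Id (B1 B) f'"] by (simp add: d)
    have "ArF (P1 Q) (ArF (P1 P) (BLUnit A f)) \<cdot>\<^bsub>B1 E\<^esub>
        (ArF (P1 Q) (PMult P (BId A t, f)) \<cdot>\<^bsub>B1 E\<^esub> PMult Q (ObF (P1 P) (BId A t), f')) \<cdot>\<^bsub>B1 E\<^esub>
        ((ArF (P1 Q) (PUnit P t) \<cdot>\<^bsub>B1 E\<^esub> PUnit Q t') \<odot>\<^bsub>BComp E\<^esub> Id (B1 E) (ObF (P1 Q) f')) =
      ArF (P1 Q) (ArF (P1 P) (BLUnit A f)) \<cdot>\<^bsub>B1 E\<^esub>
        ArF (P1 Q) (PMult P (BId A t, f)) \<cdot>\<^bsub>B1 E\<^esub>
        (PMult Q (ObF (P1 P) (BId A t), f') \<cdot>\<^bsub>B1 E\<^esub>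
         (ArF (P1 Q) (PUnit P t) \<odot>\<^bsub>BComp E\<^esub> Id (B1 E) (ObF (P1 Q) f'))) \<cdot>\<^bsub>B1 E\<^esub>
         (PUnit Q t' \<odot>\<^bsub>BComp E\<^esub> Id (B1 E) (ObF (P1 Q) f'))"
      using ty by (simp add: d assoc Q.B.whisker_right)
    also have "\<dots> = ArF (P1 Q) (ArF (P1 P) (BLUnit A f) \<cdot>\<^bsub>B1 B\<^esub> PMult P (BId A t, f) \<cdot>\<^bsub>B1 B\<^esub>
        (PUnit P t \<odot>\<^bsub>BComp B\<^esub> Id (B1 B) f')) \<cdot>\<^bsub>B1 E\<^esub>
        PMult Q (BId B t', f') \<cdot>\<^bsub>B1 E\<^esub> (PUnit Q t' \<odot>\<^bsub>BComp E\<^esub> Id (B1 E) (ObF (P1 Q) f'))"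
      unfolding l using ty by (simp add: d assoc Q.P1.ArF_Comp)
    \<comment> \<open>The argument of \<open>P1 Q\<close> collapses to \<open>BLUnit B f'\<close> by
      the unit axiom for \<open>P\<close>, which leaves exactly the unit axiom for \<open>Q\<close>
      at \<open>f'\<close>.\<close>
    also have "\<dots> = BLUnit E (ObF (P1 Q) f')"
      using P.BLUnit_coherence[of f] Q.BLUnit_coherence[of f'] ty by (simp add: d)
    finally show ?case
      using ty by (simp add: comp_psfun_def comp_functor_def compose_def d)
  next
    case (9 f)
    define t f' t' where d: "t = BSrc A f" "f' = ObF (P1 P) f" "t' = P0 P t"
    have ty: "f \<in> Obj (B1 A)" "t \<in> B0 A"
      using 9 by (simp_all add: d)
    note assoc = Q.B.B1.Comp_assoc
    have l: "PMult Q (f', ObF (P1 P) (BId A t)) \<cdot>\<^bsub>B1 E\<^esub>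
         (Id (B1 E) (ObF (P1 Q) f') \<odot>\<^bsub>BComp E\<^esub> ArF (P1 Q) (PUnit P t)) =
        ArF (P1 Q) (Id (B1 B) f' \<odot>\<^bsub>BComp B\<^esub> PUnit P t) \<cdot>\<^bsub>B1 E\<^esub> PMult Q (f', BId B t')"
      using ty Q_mult[of "Id (B1 B) f'" "PUnit P t"] by (simp add: d)
    have "ArF (P1 Q) (ArF (P1 P) (BRUnit A f)) \<cdot>\<^bsub>B1 E\<^esub>
        (ArF (P1 Q) (PMult P (f, BId A t)) \<cdot>\<^bsub>B1 E\<^esub> PMult Q (f', ObF (P1 P) (BId A t))) \<cdot>\<^bsub>B1 E\<^esub>
        (Id (B1 E) (ObF (P1 Q) f') \<odot>\<^bsub>BComp E\<^esub> (ArF (P1 Q) (PUnit P t) \<cdot>\<^bsub>B1 E\<^esub> PUnit Q t')) =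
      ArF (P1 Q) (ArF (P1 P) (BRUnit A f)) \<cdot>\<^bsub>B1 E\<^esub>
        ArF (P1 Q) (PMult P (f, BId A t)) \<cdot>\<^bsub>B1 E\<^esub>
        (PMult Q (f', ObF (P1 P) (BId A t)) \<cdot>\<^bsub>B1 E\<^esub>
         (Id (B1 E) (ObF (P1 Q) f') \<odot>\<^bsub>BComp E\<^esub> ArF (P1 Q) (PUnit P t))) \<cdot>\<^bsub>B1 E\<^esub>
         (Id (B1 E) (ObF (P1 Q) f') \<odot>\<^bsub>BComp E\<^esub> PUnit Q t')"
      using ty by (simp add: d assoc Q.B.whisker_left)
    also have "\<dots> = ArF (P1 Q) (ArF (P1 P) (BRUnit A f) \<cdot>\<^bsub>B1 B\<^esub> PMult P (f, BId A t) \<cdot>\<^bsub>B1 B\<^esub>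
        (Id (B1 B) f' \<odot>\<^bsub>BComp B\<^esub> PUnit P t)) \<cdot>\<^bsub>B1 E\<^esub>
        PMult Q (f', BId B t') \<cdot>\<^bsub>B1 E\<^esub> (Id (B1 E) (ObF (P1 Q) f') \<odot>\<^bsub>BComp E\<^esub> PUnit Q t')"
      unfolding l using ty by (simp add: d assoc Q.P1.ArF_Comp)
    also have "\<dots> = BRUnit E (ObF (P1 Q) f')"
      using P.BRUnit_coherence[of f] Q.BRUnit_coherence[of f'] ty by (simp add: d)
    finally show ?case
      using ty by (simp add: comp_psfun_def comp_functor_def compose_def d)
  qed (simp_all add: comp_psfun_def comp_functor_def compose_def ext_functor_def)
qed

section \<open>Unit and associativity laws for pseudofunctors\<close>

lemma comp_psfun_simps:
  "P0 (comp_psfun A E Q P) = compose (B0 A) (P0 Q) (P0 P)"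
  "P1 (comp_psfun A E Q P) = comp_functor (B1 A) (P1 Q) (P1 P)"
  "a \<in> B0 A \<Longrightarrow>
    PUnit (comp_psfun A E Q P) a = ArF (P1 Q) (PUnit P a) \<cdot>\<^bsub>B1 E\<^esub> PUnit Q (P0 P a)"
  "(g, f) \<in> Obj (bcomp_pairs A) \<Longrightarrow>
    PMult (comp_psfun A E Q P) (g, f) =
      ArF (P1 Q) (PMult P (g, f)) \<cdot>\<^bsub>B1 E\<^esub> PMult Q (ObF (P1 P) g, ObF (P1 P) f)"
  by (simp_all add: comp_psfun_def)

text \<open>Comparison at the cells of \<open>A\<close> is enough, since \<open>pext\<close> makes
  all components \<open>undefined\<close> elsewhere.\<close>

lemma psfun_eqI:
  assumes "pseudofunctor A B P" "pseudofunctor A B Q"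
    and "\<And>a. a \<in> B0 A \<Longrightarrow> P0 P a = P0 Q a" and "P1 P = P1 Q"
    and "\<And>a. a \<in> B0 A \<Longrightarrow> PUnit P a = PUnit Q a"
    and "\<And>g f. (g, f) \<in> Obj (bcomp_pairs A) \<Longrightarrow> PMult P (g, f) = PMult Q (g, f)"
  shows "P = Q"
proof -
  interpret P: pseudofunctor A B P by fact
  interpret Q: pseudofunctor A B Q by fact
  show ?thesis
  proof (rule psfun.equality)
    show "P0 P = P0 Q"
      by (rule extensionalityI[OF P.pext(1) Q.pext(1)]) (rule assms(3))
    show "PUnit P = PUnit Q"
      by (rule extensionalityI[OF P.pext(3) Q.pext(3)]) (rule assms(5))
    show "PMult P = PMult Q"
      by (rule extensionalityI[OF P.pext(4) Q.pext(4)]) (use assms(6) in auto)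
  qed (simp_all add: assms(4))
qed

text \<open>For unit and multiplication cells alike, both bracketings expand to three factors: the
  cell of \<open>P\<close> under \<open>Q\<close> and \<open>R\<close>, the cell of \<open>Q\<close>
  under \<open>R\<close>, and the cell of \<open>R\<close>. Functoriality of \<open>P1 R\<close> and
  associativity in \<open>K\<close> identify them.\<close>

lemma comp_psfun_assoc:
  assumes "pseudofunctor A B P" "pseudofunctor B E Q" "pseudofunctor E K R"
  shows "comp_psfun A K (comp_psfun B K R Q) P = comp_psfun A K R (comp_psfun A E Q P)"
proof (rule psfun_eqI)
  interpret P: pseudofunctor A B P by fact
  interpret Q: pseudofunctor B E Q by fact
  interpret R: pseudofunctor E K R by fact
  note [simp] = P.A.cell_simps P.B.cell_simps Q.B.cell_simps P.functor_simps Q.functor_simps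
    R.functor_simps P.A.bcomp_pairs_simps(1) P.B.bcomp_pairs_simps(1) Q.B.bcomp_pairs_simps(1)
    comp_psfun_simps R.P1.ArF_Comp R.B.B1.Comp_assoc
  show "pseudofunctor A K (comp_psfun A K (comp_psfun B K R Q) P)"
    "pseudofunctor A K (comp_psfun A K R (comp_psfun A E Q P))"
    by (rule pseudofunctor_comp[OF assms(1) pseudofunctor_comp[OF assms(2,3)]],
        rule pseudofunctor_comp[OF pseudofunctor_comp[OF assms(1,2)] assms(3)])
  show "P1 (comp_psfun A K (comp_psfun B K R Q) P) = P1 (comp_psfun A K R (comp_psfun A E Q P))"
    by (simp add: comp_functor_assoc[OF P.P1.cat_functor_axioms])
  show "P0 (comp_psfun A K (comp_psfun B K R Q) P) a = P0 (comp_psfun A K R (comp_psfun A E Q P)) a"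
    "PUnit (comp_psfun A K (comp_psfun B K R Q) P) a =
      PUnit (comp_psfun A K R (comp_psfun A E Q P)) a"
    if "a \<in> B0 A" for a
    using that by (simp_all add: compose_def comp_functor_def)
  show "PMult (comp_psfun A K (comp_psfun B K R Q) P) (g, f) =
      PMult (comp_psfun A K R (comp_psfun A E Q P)) (g, f)"
    if "(g, f) \<in> Obj (bcomp_pairs A)" for g f
    using that by (simp add: compose_def comp_functor_def)
qed

lemma comp_psfun_id:
  assumes "pseudofunctor A B P"
  shows "comp_psfun A B (id_psfun B) P = P" "comp_psfun A B P (id_psfun A) = P"
proof -
  interpret P: pseudofunctor A B P by fact
  note [simp] = P.A.cell_simps P.B.cell_simps P.functor_simps
    P.A.bcomp_pairs_simps(1) P.B.bcomp_pairs_simps(1)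
    comp_psfun_simps P.B.B1.Comp_Id' P.B.B1.Id_Comp'
  show "comp_psfun A B (id_psfun B) P = P"
    using pseudofunctor_comp[OF assms pseudofunctor_id[OF P.B.bicategory_axioms]] assms
  proof (rule psfun_eqI)
    show "P1 (comp_psfun A B (id_psfun B) P) = P1 P"
      using comp_functor_id_left[OF P.P1.cat_functor_axioms P.pext(2)] by (simp add: id_psfun_def)
  qed (simp_all add: id_psfun_def id_functor_def compose_def)
  show "comp_psfun A B P (id_psfun A) = P"
    using pseudofunctor_comp[OF pseudofunctor_id[OF P.A.bicategory_axioms] assms] assms
  proof (rule psfun_eqI)
    show "P1 (comp_psfun A B P (id_psfun A)) = P1 P"
      using comp_functor_id_right[OF P.pext(2)] by (simp add: id_psfun_def)
  qed (simp_all add: id_psfun_def id_functor_def compose_def)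
qed

section \<open>The category of decorated bicategories\<close>

lemma decorated_pseudofunctor_comp:
  assumes "decorated_pseudofunctor A B P" "decorated_pseudofunctor B E Q"
  shows "decorated_pseudofunctor A E \<lparr>Psf = comp_psfun (Bic A) (Bic E) (Psf Q) (Psf P),
    DecF = comp_functor (Dec A) (DecF Q) (DecF P)\<rparr>"
proof -
  interpret P: decorated_pseudofunctor A B P by fact
  interpret Q: decorated_pseudofunctor B E Q by fact
  show ?thesis
    unfolding decorated_pseudofunctor_def decorated_pseudofunctor_axioms_def
    using P.A.decorated_bicategory_axioms Q.B.decorated_bicategory_axioms
      pseudofunctor_comp[OF P.Psf.pseudofunctor_axioms Q.Psf.pseudofunctor_axioms]
      cat_functor_comp[OF P.DecF.cat_functor_axioms Q.DecF.cat_functor_axioms]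
    by (simp add: ext_functor_comp)
      (simp add: comp_functor_def comp_psfun_def compose_def P.A.Obj_Dec P.ObF_DecF Q.ObF_DecF
        P.Psf.P0_B0)
qed

lemma decorated_pseudofunctor_id:
  assumes "decorated_bicategory A"
  shows "decorated_pseudofunctor A A \<lparr>Psf = id_psfun (Bic A), DecF = id_functor (Dec A)\<rparr>"
proof -
  interpret decorated_bicategory A by fact
  show ?thesis
    unfolding decorated_pseudofunctor_def decorated_pseudofunctor_axioms_def
    using assms pseudofunctor_id[OF Bic.bicategory_axioms] cat_functor_id[OF Dec.category_axioms]
    by (simp add: ext_functor_id) (simp add: id_functor_def id_psfun_def Obj_Dec)
qed

lemma category_bCat_dec: "category bCat_dec"
proof -
  have Arr: "(A, P, B) \<in> Arr bCat_dec \<longleftrightarrow> decorated_pseudofunctor A B P" for A P B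
    by (simp add: bCat_dec_def)
  show ?thesis
  proof (unfold_locales, goal_cases)
    case (1 f) then show ?case
      by (auto simp: bCat_dec_def decorated_pseudofunctor_def)
  next
    case (2 f) then show ?case
      by (auto simp: bCat_dec_def decorated_pseudofunctor_def)
  next
    case (3 a) then show ?case
      by (simp add: bCat_dec_def decorated_pseudofunctor_id)
  next
    case (6 f g) then show ?case
      by (auto simp: bCat_dec_def decorated_pseudofunctor_comp)
  next
    case (9 f)
    obtain A P B where f: "f = (A, P, B)" by (cases f)
    with 9 interpret P: decorated_pseudofunctor A B P by (simp add: Arr)
    show ?case
      unfolding f bCat_dec_def
      using comp_psfun_id[OF P.Psf.pseudofunctor_axioms] comp_functor_id_right[OF P.ext_DecF]
      by simp
  next
    case (10 f)
    obtain A P B where f: "f = (A, P, B)" by (cases f)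
    with 10 interpret P: decorated_pseudofunctor A B P by (simp add: Arr)
    show ?case
      unfolding f bCat_dec_def
      using comp_psfun_id[OF P.Psf.pseudofunctor_axioms]
        comp_functor_id_left[OF P.DecF.cat_functor_axioms P.ext_DecF]
      by simp
  next
    case (11 f g h)
    obtain A P B where f: "f = (A, P, B)" by (cases f)
    obtain B' Q E where g: "g = (B', Q, E)" by (cases g)
    obtain E' R K where h: "h = (E', R, K)" by (cases h)
    from 11 f g h have [simp]: "B' = B" "E' = E"
      by (simp_all add: bCat_dec_def)
    interpret P: decorated_pseudofunctor A B P using 11 f by (simp add: Arr)
    interpret Q: decorated_pseudofunctor B E Q using 11 g by (simp add: Arr)
    interpret R: decorated_pseudofunctor E K R using 11 h by (simp add: Arr)
    show ?case
      unfolding f g h bCat_dec_def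
      using comp_psfun_assoc[OF P.Psf.pseudofunctor_axioms Q.Psf.pseudofunctor_axioms
          R.Psf.pseudofunctor_axioms] comp_functor_assoc[OF P.DecF.cat_functor_axioms]
      by simp
  qed (auto simp: bCat_dec_def)
qed

section \<open>The horizontal bicategory\<close>

context double_category
begin

lemma comp_pairs_simps:
  "(g, f) \<in> Obj (comp_pairs C) \<longleftrightarrow>
     g \<in> Obj (C1 C) \<and> f \<in> Obj (C1 C) \<and> ObF (Src C) g = ObF (Tgt C) f"
  "(\<beta>, \<alpha>) \<in> Arr (comp_pairs C) \<longleftrightarrow>
     \<beta> \<in> Arr (C1 C) \<and> \<alpha> \<in> Arr (C1 C) \<and> ArF (Src C) \<beta> = ArF (Tgt C) \<alpha>"
  "Dom (comp_pairs C) (\<beta>, \<alpha>) = (Dom (C1 C) \<beta>, Dom (C1 C) \<alpha>)"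
  "Cod (comp_pairs C) (\<beta>, \<alpha>) = (Cod (C1 C) \<beta>, Cod (C1 C) \<alpha>)"
  "Id (comp_pairs C) (g, f) = (Id (C1 C) g, Id (C1 C) f)"
  "(\<beta>', \<alpha>') \<cdot>\<^bsub>comp_pairs C\<^esub> (\<beta>, \<alpha>) = (\<beta>' \<cdot>\<^bsub>C1 C\<^esub> \<beta>, \<alpha>' \<cdot>\<^bsub>C1 C\<^esub> \<alpha>)"
  by (simp_all add: comp_pairs_def fiber_product_def)

lemma hcomp_square:
  assumes "\<beta> \<in> Arr (C1 C)" "\<alpha> \<in> Arr (C1 C)" "ArF (Src C) \<beta> = ArF (Tgt C) \<alpha>"
  shows "\<beta> \<odot>\<^bsub>HComp C\<^esub> \<alpha> \<in> Arr (C1 C)"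
    and "Dom (C1 C) (\<beta> \<odot>\<^bsub>HComp C\<^esub> \<alpha>) = Dom (C1 C) \<beta> \<star>\<^bsub>HComp C\<^esub> Dom (C1 C) \<alpha>"
    and "Cod (C1 C) (\<beta> \<odot>\<^bsub>HComp C\<^esub> \<alpha>) = Cod (C1 C) \<beta> \<star>\<^bsub>HComp C\<^esub> Cod (C1 C) \<alpha>"
    and "ArF (Src C) (\<beta> \<odot>\<^bsub>HComp C\<^esub> \<alpha>) = ArF (Src C) \<alpha>"
    and "ArF (Tgt C) (\<beta> \<odot>\<^bsub>HComp C\<^esub> \<alpha>) = ArF (Tgt C) \<beta>"
  using assms HComp.ArF_Arr[of "(\<beta>, \<alpha>)"] HComp.Dom_ArF[of "(\<beta>, \<alpha>)"] HComp.Cod_ArF[of "(\<beta>, \<alpha>)"]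
    Src_HComp(2)[of \<beta> \<alpha>] Tgt_HComp(2)[of \<beta> \<alpha>]
  by (simp_all add: comp_pairs_simps)

section \<open>Globular squares and their closure properties\<close>

text \<open>An identity arrow is the identity of its own domain, so membership of an edge in the
  image of \<open>Id\<close> becomes an equation that names the object.\<close>

lemma globular_iff:
  "\<alpha> \<in> globular C \<longleftrightarrow> \<alpha> \<in> Arr (C1 C) \<and>
     ArF (Src C) \<alpha> = Id (C0 C) (ObF (Src C) (Dom (C1 C) \<alpha>)) \<and>
     ArF (Tgt C) \<alpha> = Id (C0 C) (ObF (Tgt C) (Dom (C1 C) \<alpha>))"
proof (cases "\<alpha> \<in> Arr (C1 C)")
  case True
  have "v \<in> Id (C0 C) ` Obj (C0 C) \<longleftrightarrow> v = Id (C0 C) (Dom (C0 C) v)" if "v \<in> Arr (C0 C)" for v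
    using that by (auto simp: Src.B.Dom_Obj Src.B.Dom_Id)
  then show ?thesis
    using True by (auto simp: globular_def Src.ArF_Arr Tgt.ArF_Arr Src.Dom_ArF Tgt.Dom_ArF)
qed (simp add: globular_def)

lemma globular_cell:
  assumes "\<alpha> \<in> globular C"
  shows "\<alpha> \<in> Arr (C1 C)"
    and "ArF (Src C) \<alpha> = Id (C0 C) (ObF (Src C) (Dom (C1 C) \<alpha>))"
    and "ArF (Tgt C) \<alpha> = Id (C0 C) (ObF (Tgt C) (Dom (C1 C) \<alpha>))"
    and "ObF (Src C) (Cod (C1 C) \<alpha>) = ObF (Src C) (Dom (C1 C) \<alpha>)"
    and "ObF (Tgt C) (Cod (C1 C) \<alpha>) = ObF (Tgt C) (Dom (C1 C) \<alpha>)"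
proof -
  show a: "\<alpha> \<in> Arr (C1 C)"
    and s: "ArF (Src C) \<alpha> = Id (C0 C) (ObF (Src C) (Dom (C1 C) \<alpha>))"
    and t: "ArF (Tgt C) \<alpha> = Id (C0 C) (ObF (Tgt C) (Dom (C1 C) \<alpha>))"
    using assms by (simp_all add: globular_iff)
  show "ObF (Src C) (Cod (C1 C) \<alpha>) = ObF (Src C) (Dom (C1 C) \<alpha>)"
    using a s Src.Cod_ArF[of \<alpha>] by (simp add: Src.B.Cod_Id Src.ObF_Obj Src.A.Dom_Obj)
  show "ObF (Tgt C) (Cod (C1 C) \<alpha>) = ObF (Tgt C) (Dom (C1 C) \<alpha>)"
    using a t Tgt.Cod_ArF[of \<alpha>] by (simp add: Src.B.Cod_Id Tgt.ObF_Obj Src.A.Dom_Obj)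
qed

lemma globular_Id: "f \<in> Obj (C1 C) \<Longrightarrow> Id (C1 C) f \<in> globular C"
  by (simp add: globular_iff Src.A.Id_Arr Src.A.Dom_Id Src.ArF_Id Tgt.ArF_Id)

lemma globular_Comp:
  assumes "\<alpha> \<in> globular C" "\<beta> \<in> globular C" "Dom (C1 C) \<beta> = Cod (C1 C) \<alpha>"
  shows "\<beta> \<cdot>\<^bsub>C1 C\<^esub> \<alpha> \<in> globular C"
  using assms(3) globular_cell[OF assms(1)] globular_cell[OF assms(2)]
    Src.ObF_Obj[OF Src.A.Dom_Obj, of \<alpha>] Tgt.ObF_Obj[OF Src.A.Dom_Obj, of \<alpha>]
    Src.B.Comp_Id[OF Src.B.Id_Arr]
  by (simp add: globular_iff Src.A.Comp_Arr Src.A.Dom_Comp Src.ArF_Comp Tgt.ArF_Comp Src.B.Dom_Id)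

text \<open>Identity arrows agree exactly when their objects do. This reconciles the two notions of
  composable pair: equal edges in \<open>comp_pairs\<close>, equal 0-cells in
  \<open>bcomp_pairs\<close>.\<close>

lemma globular_composable:
  assumes "\<alpha> \<in> globular C" "\<beta> \<in> globular C"
  shows "ArF (Src C) \<beta> = ArF (Tgt C) \<alpha> \<longleftrightarrow>
    ObF (Src C) (Dom (C1 C) \<beta>) = ObF (Tgt C) (Dom (C1 C) \<alpha>)"
  using globular_cell[OF assms(1)] globular_cell[OF assms(2)]
  by (metis Src.Dom_ArF Tgt.Dom_ArF)

lemma globular_hcomp:
  assumes "\<alpha> \<in> globular C" "\<beta> \<in> globular C"
    and "ObF (Src C) (Dom (C1 C) \<beta>) = ObF (Tgt C) (Dom (C1 C) \<alpha>)"
  shows "\<beta> \<odot>\<^bsub>HComp C\<^esub> \<alpha> \<in> globular C"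
proof -
  have "ArF (Src C) \<beta> = ArF (Tgt C) \<alpha>"
    using globular_composable assms by blast
  then show ?thesis
    using globular_cell[OF assms(1)] globular_cell[OF assms(2)] assms(3)
      Src_HComp(1) Tgt_HComp(1)
    by (simp add: globular_iff hcomp_square comp_pairs_simps Src.A.Dom_Obj)
qed

text \<open>Applying \<open>Src\<close> and \<open>Tgt\<close> to the equation gives identities, and
  the edges of \<alpha> already are identities; hence so are those of \<beta>. Thus the invertible
  globular cells of \<open>C\<close> stay invertible in \<open>HBic\<close>, whose 2-cells are
  globular only.\<close>

lemma globular_inverse:
  assumes "\<alpha> \<in> globular C" "\<beta> \<in> Arr (C1 C)" "Dom (C1 C) \<beta> = Cod (C1 C) \<alpha>"
    and "\<beta> \<cdot>\<^bsub>C1 C\<^esub> \<alpha> = Id (C1 C) (Dom (C1 C) \<alpha>)"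
  shows "\<beta> \<in> globular C"
proof -
  note a = globular_cell[OF assms(1)]
  have "ArF (Src C) \<beta> = ArF (Src C) \<beta> \<cdot>\<^bsub>C0 C\<^esub> ArF (Src C) \<alpha>"
    using a assms(2,3) by (simp add: Src.B.Comp_Id' Src.ArF_Arr Src.Dom_ArF)
  also have "\<dots> = Id (C0 C) (ObF (Src C) (Dom (C1 C) \<beta>))"
    using a(1,4,5) assms(2-4) Src.ArF_Comp[of \<alpha> \<beta>] by (simp add: Src.A.Dom_Obj Src.ArF_Id)
  finally have s: "ArF (Src C) \<beta> = Id (C0 C) (ObF (Src C) (Dom (C1 C) \<beta>))" .
  have "ArF (Tgt C) \<beta> = ArF (Tgt C) \<beta> \<cdot>\<^bsub>C0 C\<^esub> ArF (Tgt C) \<alpha>"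
    using a assms(2,3) by (simp add: Src.B.Comp_Id' Tgt.ArF_Arr Tgt.Dom_ArF)
  also have "\<dots> = Id (C0 C) (ObF (Tgt C) (Dom (C1 C) \<beta>))"
    using a(1,4,5) assms(2-4) Tgt.ArF_Comp[of \<alpha> \<beta>] by (simp add: Src.A.Dom_Obj Tgt.ArF_Id)
  finally have t: "ArF (Tgt C) \<beta> = Id (C0 C) (ObF (Tgt C) (Dom (C1 C) \<beta>))" .
  show ?thesis
    using s t assms(2) by (simp add: globular_iff)
qed

section \<open>Assembling the bicategory of globular squares\<close>

lemma HBic_simps:
  "B0 (HBic C) = Obj (C0 C)" "BSrc (HBic C) = ObF (Src C)" "BTgt (HBic C) = ObF (Tgt C)"
  "BId (HBic C) = ObF (HId C)" "BComp (HBic C) = HComp C" "BAssoc (HBic C) = Assoc C"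
  "BLUnit (HBic C) = LUnit C" "BRUnit (HBic C) = RUnit C"
  "Obj (B1 (HBic C)) = Obj (C1 C)" "Arr (B1 (HBic C)) = globular C" "Dom (B1 (HBic C)) = Dom (C1 C)"
  "Cod (B1 (HBic C)) = Cod (C1 C)" "Id (B1 (HBic C)) = Id (C1 C)" "Comp (B1 (HBic C)) = Comp (C1 C)"
  by (simp_all add: HBic_def)

lemma bcomp_pairs_HBic:
  "Obj (bcomp_pairs (HBic C)) = Obj (comp_pairs C)"
  "(\<beta>, \<alpha>) \<in> Arr (bcomp_pairs (HBic C)) \<longleftrightarrow> \<beta> \<in> globular C \<and> \<alpha> \<in> globular C \<and>
     ObF (Src C) (Dom (C1 C) \<beta>) = ObF (Tgt C) (Dom (C1 C) \<alpha>)"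
  "Dom (bcomp_pairs (HBic C)) (\<beta>, \<alpha>) = (Dom (C1 C) \<beta>, Dom (C1 C) \<alpha>)"
  "Cod (bcomp_pairs (HBic C)) (\<beta>, \<alpha>) = (Cod (C1 C) \<beta>, Cod (C1 C) \<alpha>)"
  "Id (bcomp_pairs (HBic C)) (g, f) = (Id (C1 C) g, Id (C1 C) f)"
  "(\<beta>', \<alpha>') \<cdot>\<^bsub>bcomp_pairs (HBic C)\<^esub> (\<beta>, \<alpha>) = (\<beta>' \<cdot>\<^bsub>C1 C\<^esub> \<beta>, \<alpha>' \<cdot>\<^bsub>C1 C\<^esub> \<alpha>)"
  by (auto simp: bcomp_pairs_def comp_pairs_def fiber_product_def discrete_fctr_def HBic_simps)

lemma iso_arr_HBic: "\<alpha> \<in> globular C \<Longrightarrow> iso_arr (C1 C) \<alpha> \<Longrightarrow> iso_arr (B1 (HBic C)) \<alpha>"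
  unfolding iso_arr_def HBic_simps using globular_inverse by blast

lemma globular_pair_Arr: "x \<in> Arr (bcomp_pairs (HBic C)) \<Longrightarrow> x \<in> Arr (comp_pairs C)"
  by (cases x) (use globular_composable globular_cell(1) in \<open>auto simp: bcomp_pairs_HBic comp_pairs_simps\<close>)

lemma category_HBic: "category (B1 (HBic C))"
  by unfold_locales
    (simp_all add: HBic_simps globular_Id globular_Comp globular_cell(1) Src.A.Dom_Obj Src.A.Cod_Obj
      Src.A.Dom_Id Src.A.Cod_Id Src.A.Dom_Comp Src.A.Cod_Comp Src.A.Comp_Id Src.A.Id_Comp
      Src.A.Comp_assoc)

lemma category_bcomp_pairs_HBic: "category (bcomp_pairs (HBic C))"
proof (unfold_locales, goal_cases)
  case (1 f) then show ?case
    by (cases f) (auto simp: bcomp_pairs_HBic comp_pairs_simps globular_cell Src.A.Dom_Obj)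
next
  case (2 f) then show ?case
    by (cases f) (auto simp: bcomp_pairs_HBic comp_pairs_simps globular_cell Src.A.Cod_Obj)
next
  case (3 a) then show ?case
    by (cases a) (auto simp: bcomp_pairs_HBic comp_pairs_simps globular_Id Src.A.Dom_Id)
next
  case (4 a) then show ?case
    by (cases a) (auto simp: bcomp_pairs_HBic comp_pairs_simps Src.A.Dom_Id)
next
  case (5 a) then show ?case
    by (cases a) (auto simp: bcomp_pairs_HBic comp_pairs_simps Src.A.Cod_Id)
next
  case (6 f g) then show ?case
    by (cases f; cases g)
      (auto simp: bcomp_pairs_HBic globular_cell globular_Comp Src.A.Dom_Comp)
next
  case (7 f g) then show ?case
    by (cases f; cases g) (auto simp: bcomp_pairs_HBic globular_cell Src.A.Dom_Comp)
next
  case (8 f g) then show ?case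
    by (cases f; cases g) (auto simp: bcomp_pairs_HBic globular_cell Src.A.Cod_Comp)
next
  case (9 f) then show ?case
    by (cases f) (auto simp: bcomp_pairs_HBic globular_cell Src.A.Comp_Id)
next
  case (10 f) then show ?case
    by (cases f) (auto simp: bcomp_pairs_HBic globular_cell Src.A.Id_Comp)
next
  case (11 f g h) then show ?case
    by (cases f; cases g; cases h) (auto simp: bcomp_pairs_HBic globular_cell Src.A.Comp_assoc)
qed

lemma cat_functor_HComp_HBic: "cat_functor (bcomp_pairs (HBic C)) (B1 (HBic C)) (HComp C)"
proof (intro cat_functor.intro category_bcomp_pairs_HBic category_HBic cat_functor_axioms.intro, goal_cases)
  case (1 a) then show ?case
    by (simp add: bcomp_pairs_HBic HBic_simps HComp.ObF_Obj)
next
  case (2 f) then show ?case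
    by (cases f) (simp add: bcomp_pairs_HBic HBic_simps globular_hcomp)
next
  case (3 f) then show ?case
    using HComp.Dom_ArF[OF globular_pair_Arr[OF 3]]
    by (cases f) (simp add: bcomp_pairs_HBic HBic_simps comp_pairs_simps)
next
  case (4 f) then show ?case
    using HComp.Cod_ArF[OF globular_pair_Arr[OF 4]]
    by (cases f) (simp add: bcomp_pairs_HBic HBic_simps comp_pairs_simps)
next
  case (5 a) then show ?case
    using HComp.ArF_Id[of a]
    by (cases a) (simp add: bcomp_pairs_HBic HBic_simps comp_pairs_simps)
next
  case (6 f g) then show ?case
    using HComp.ArF_Comp[OF globular_pair_Arr[OF 6(1)] globular_pair_Arr[OF 6(2)]]
    by (cases f; cases g) (simp add: bcomp_pairs_HBic HBic_simps comp_pairs_simps)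
qed

lemma bicategory_HBic: "bicategory (HBic C)"
proof -
  interpret category "B1 (HBic C)"
    by (rule category_HBic)
  interpret cat_functor "bcomp_pairs (HBic C)" "B1 (HBic C)" "BComp (HBic C)"
    using cat_functor_HComp_HBic by (simp add: HBic_simps)
  show ?thesis
  proof (unfold_locales, unfold bcomp_pairs_HBic(1) HBic_simps, goal_cases)
    case (10 h g f) then show ?case
      using Assoc_cell by (simp add: iso_arr_HBic)
  next
    case (11 f) then show ?case
      using LUnit_cell by (simp add: iso_arr_HBic)
  next
    case (12 f) then show ?case
      using RUnit_cell by (simp add: iso_arr_HBic)
  next
    case (13 \<gamma> \<beta> \<alpha>) then show ?case
      by (simp add: Assoc_natural globular_pair_Arr)
  next
    \<comment> \<open>The double category whiskers with the horizontal identity of an edge of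
      \<alpha>, the bicategory with the identity 2-cell of a unit 1-cell. For globular \<alpha> the
      edge is an identity and \<open>HId\<close> preserves identities.\<close>
    case (14 \<alpha>) then show ?case
      using LUnit_natural[of \<alpha>] by (simp add: globular_cell HId.ArF_Id Tgt.ObF_Obj Src.A.Dom_Obj)
  next
    case (15 \<alpha>) then show ?case
      using RUnit_natural[of \<alpha>] by (simp add: globular_cell HId.ArF_Id Src.ObF_Obj Src.A.Dom_Obj)
  next
    case 16 then show ?case by (rule pentagon)
  next
    case 17 then show ?case by (rule triangle)
  qed (simp_all add: Src.ObF_Obj Tgt.ObF_Obj globular_cell HId.ObF_Obj Src_HId Tgt_HId Src_HComp Tgt_HComp)
qed

lemma decorated_bicategory_Hstar_obj: "decorated_bicategory (Hstar_obj C)"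
  by (simp add: Hstar_obj_def decorated_bicategory_def decorated_bicategory_axioms_def
      bicategory_HBic Src.B.category_axioms HBic_simps)

end

section \<open>Double functors\<close>

lemma Hstar_fun_simps:
  "DecF (Hstar_fun C F) = F0 F"
  "P0 (Psf (Hstar_fun C F)) = ObF (F0 F)"
  "ObF (P1 (Psf (Hstar_fun C F))) = ObF (F1 F)"
  "ArF (P1 (Psf (Hstar_fun C F))) = restrict (ArF (F1 F)) (globular C)"
  "PUnit (Psf (Hstar_fun C F)) = FUnit F"
  "PMult (Psf (Hstar_fun C F)) = FMult F"
  by (simp_all add: Hstar_fun_def)

text \<open>\<open>Hstar_fun\<close> keeps \<open>F0\<close>, \<open>FUnit\<close> and
  \<open>FMult\<close> unchanged and loses only the values of \<open>F1\<close> on squares that are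
  not globular. Equations between double functors thus split into one for decorated pseudofunctors
  and one for \<open>F1\<close>.\<close>

lemma dbl_fun_eqI: "Hstar_fun C F = Hstar_fun C G \<Longrightarrow> F1 F = F1 G \<Longrightarrow> F = G"
  by (rule dbl_fun.equality) (simp_all add: Hstar_fun_def)

section \<open>The pseudofunctor underlying a double functor, and the way back\<close>

context double_functor
begin

text \<open>The edges of the image are the \<open>F0\<close>-images of identities.\<close>

lemma F1_globular: "\<alpha> \<in> globular C \<Longrightarrow> ArF (F1 F) \<alpha> \<in> globular D"
  using C.globular_cell[of \<alpha>]
  by (simp add: D.globular_iff F1.ArF_Arr F1.Dom_ArF Src_F1 Tgt_F1 C.Src.A.Dom_Obj
      F0.ArF_Id C.Src.ObF_Obj C.Tgt.ObF_Obj)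

lemma F_cells:
  "a \<in> Obj (C0 C) \<Longrightarrow> FUnit F a \<in> globular D"
  "a \<in> Obj (C0 C) \<Longrightarrow> FUnit F a \<in> Arr (C1 D)"
  "a \<in> Obj (C0 C) \<Longrightarrow> Dom (C1 D) (FUnit F a) = ObF (HId D) (ObF (F0 F) a)"
  "a \<in> Obj (C0 C) \<Longrightarrow> Cod (C1 D) (FUnit F a) = ObF (F1 F) (ObF (HId C) a)"
  "\<lbrakk>g \<in> Obj (C1 C); f \<in> Obj (C1 C); ObF (Src C) g = ObF (Tgt C) f\<rbrakk> \<Longrightarrow> FMult F (g, f) \<in> globular D"
  "\<lbrakk>g \<in> Obj (C1 C); f \<in> Obj (C1 C); ObF (Src C) g = ObF (Tgt C) f\<rbrakk> \<Longrightarrow> FMult F (g, f) \<in> Arr (C1 D)"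
  "\<lbrakk>g \<in> Obj (C1 C); f \<in> Obj (C1 C); ObF (Src C) g = ObF (Tgt C) f\<rbrakk> \<Longrightarrow>
    Dom (C1 D) (FMult F (g, f)) = ObF (F1 F) g \<star>\<^bsub>HComp D\<^esub> ObF (F1 F) f"
  "\<lbrakk>g \<in> Obj (C1 C); f \<in> Obj (C1 C); ObF (Src C) g = ObF (Tgt C) f\<rbrakk> \<Longrightarrow>
    Cod (C1 D) (FMult F (g, f)) = ObF (F1 F) (g \<star>\<^bsub>HComp C\<^esub> f)"
  using FUnit_cell[of a] FMult_cell[of g f] D.globular_cell(1)
  by (simp_all add: C.comp_pairs_simps)

lemma cat_functor_Hstar_fun:
  "cat_functor (B1 (HBic C)) (B1 (HBic D)) (P1 (Psf (Hstar_fun C F)))"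
proof (intro cat_functor.intro C.category_HBic D.category_HBic cat_functor_axioms.intro,
    unfold C.HBic_simps D.HBic_simps Hstar_fun_simps, goal_cases)
qed (simp_all add: F1.ObF_Obj F1_globular F1.Dom_ArF F1.Cod_ArF F1.ArF_Id F1.ArF_Comp
    C.globular_cell C.globular_Id C.globular_Comp)

lemma pseudofunctor_Hstar_fun: "pseudofunctor (HBic C) (HBic D) (Psf (Hstar_fun C F))"
proof (intro pseudofunctor.intro C.bicategory_HBic D.bicategory_HBic cat_functor_Hstar_fun
    pseudofunctor_axioms.intro,
    unfold C.bcomp_pairs_HBic(1) C.HBic_simps D.HBic_simps Hstar_fun_simps, goal_cases)
  case (4 a) then show ?case
    using FUnit_cell by (simp add: D.iso_arr_HBic)
next
  case (5 g f) then show ?case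
    using FMult_cell by (simp add: D.iso_arr_HBic)
next
  case (6 \<beta> \<alpha>)
  \<comment> \<open>The horizontal composite has to be globular as well, so that the restricted
    action of \<open>F1\<close> takes its true value there. In the three coherence cases the
    \<open>_cell\<close> facts serve the same purpose.\<close>
  then have "(\<beta>, \<alpha>) \<in> Arr (comp_pairs C)" "\<beta> \<in> globular C" "\<alpha> \<in> globular C"
      "\<beta> \<odot>\<^bsub>HComp C\<^esub> \<alpha> \<in> globular C"
    using C.globular_pair_Arr by (auto simp: C.bcomp_pairs_HBic C.globular_hcomp)
  then show ?case
    by (simp add: FMult_natural)
next
  case (7 h g f) then show ?case
    using C.Assoc_cell Assoc_coherence by simp
next
  case (8 f) then show ?case
    using C.LUnit_cell LUnit_coherence by simp
next
  case (9 f) then show ?case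
    using C.RUnit_cell RUnit_coherence by simp
qed (use ext in \<open>simp_all add: F0.ObF_Obj Src_F1 Tgt_F1 ext_functor_def C.HBic_simps Hstar_fun_simps\<close>)

lemma decorated_pseudofunctor_Hstar_fun:
  "decorated_pseudofunctor (Hstar_obj C) (Hstar_obj D) (Hstar_fun C F)"
  using C.decorated_bicategory_Hstar_obj D.decorated_bicategory_Hstar_obj pseudofunctor_Hstar_fun
    F0.cat_functor_axioms ext(1)
  by (simp add: decorated_pseudofunctor_def decorated_pseudofunctor_axioms_def Hstar_obj_def
      Hstar_fun_simps)

end

text \<open>The coherence axioms only involve globular squares, so they can be checked in \<^const>\<open>HBic\<close>.\<close>

lemma double_functorI:
  assumes "double_category C" "double_category D"
    and "cat_functor (C0 C) (C0 D) (F0 F)" "cat_functor (C1 C) (C1 D) (F1 F)"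
    and "ext_functor (C0 C) (F0 F)" "ext_functor (C1 C) (F1 F)"
    and "pseudofunctor (HBic C) (HBic D) (Psf (Hstar_fun C F))"
    and Src: "\<And>\<alpha>. \<alpha> \<in> Arr (C1 C) \<Longrightarrow> ArF (Src D) (ArF (F1 F) \<alpha>) = ArF (F0 F) (ArF (Src C) \<alpha>)"
    and Tgt: "\<And>\<alpha>. \<alpha> \<in> Arr (C1 C) \<Longrightarrow> ArF (Tgt D) (ArF (F1 F) \<alpha>) = ArF (F0 F) (ArF (Tgt C) \<alpha>)"
    and unit: "\<And>v. v \<in> Arr (C0 C) \<Longrightarrow>
        FUnit F (Cod (C0 C) v) \<cdot>\<^bsub>C1 D\<^esub> ArF (HId D) (ArF (F0 F) v) =
        ArF (F1 F) (ArF (HId C) v) \<cdot>\<^bsub>C1 D\<^esub> FUnit F (Dom (C0 C) v)"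
    and mult: "\<And>\<beta> \<alpha>. (\<beta>, \<alpha>) \<in> Arr (comp_pairs C) \<Longrightarrow>
        FMult F (Cod (C1 C) \<beta>, Cod (C1 C) \<alpha>) \<cdot>\<^bsub>C1 D\<^esub> (ArF (F1 F) \<beta> \<odot>\<^bsub>HComp D\<^esub> ArF (F1 F) \<alpha>) =
        ArF (F1 F) (\<beta> \<odot>\<^bsub>HComp C\<^esub> \<alpha>) \<cdot>\<^bsub>C1 D\<^esub> FMult F (Dom (C1 C) \<beta>, Dom (C1 C) \<alpha>)"
  shows "double_functor C D F"
proof -
  interpret C: double_category C by fact
  interpret D: double_category D by fact
  interpret P: pseudofunctor "HBic C" "HBic D" "Psf (Hstar_fun C F)" by fact
  note S = C.bcomp_pairs_HBic(1) C.HBic_simps D.HBic_simps Hstar_fun_simps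
  \<comment> \<open>The converse of \<open>iso_arr_HBic\<close>: a 2-cell of \<open>HBic D\<close>
    is globular, and its inverse there is in particular a square of \<open>D\<close>.\<close>
  have iso: "\<alpha> \<in> globular D \<and> iso_arr (C1 D) \<alpha>" if "iso_arr (B1 (HBic D)) \<alpha>" for \<alpha>
    using that D.globular_cell(1) unfolding iso_arr_def S by blast
  show ?thesis
  proof (intro double_functor.intro double_functor_axioms.intro assms(1-4), goal_cases)
    case (1 f) then show ?case using P.BSrc_P1[unfolded S] by blast
  next
    case (2 \<alpha>) then show ?case by (rule Src)
  next
    case (3 f) then show ?case using P.BTgt_P1[unfolded S] by blast
  next
    case (4 \<alpha>) then show ?case by (rule Tgt)
  next
    case (5 a) then show ?case using P.PUnit_cell[of a] iso unfolding S by blast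
  next
    case (6 g f) then show ?case using P.PMult_cell[of g f] iso unfolding S by blast
  next
    case (7 v) then show ?case by (rule unit)
  next
    case (8 \<beta> \<alpha>) then show ?case by (rule mult)
  next
    case (9 h g f) then show ?case
      using P.BAssoc_coherence[of h g f] C.Assoc_cell unfolding S by simp
  next
    case (10 f) then show ?case
      using P.BLUnit_coherence[of f] C.LUnit_cell unfolding S by simp
  next
    case (11 f) then show ?case
      using P.BRUnit_coherence[of f] C.RUnit_cell unfolding S by simp
  next
    case 14 then show ?case using P.pext(3) unfolding S .
  next
    case 15 then show ?case using P.pext(4) unfolding S .
  qed (fact assms)+
qed

section \<open>Functoriality of the horizontalization and the category of double categories\<close>

lemma Hstar_fun_id:
  "Hstar_fun C (id_dbl_fun C) = \<lparr>Psf = id_psfun (HBic C), DecF = id_functor (C0 C)\<rparr>"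
proof -
  have "globular C \<subseteq> Arr (C1 C)"
    by (auto simp: globular_def)
  then show ?thesis
    by (auto simp: Hstar_fun_def id_dbl_fun_def id_psfun_def HBic_def id_functor_def fun_eq_iff
        bcomp_pairs_def comp_pairs_def fiber_product_def discrete_fctr_def)
qed

text \<open>The action of \<open>G\<close> has been cut down to globular squares of
  \<open>D\<close>, so the two sides agree because \<open>F\<close> sends globular squares to
  globular squares and has globular unit and multiplication cells.\<close>

lemma Hstar_fun_comp:
  assumes "double_functor C D F" "double_category E"
  shows "Hstar_fun C (comp_dbl_fun C E G F) =
    \<lparr>Psf = comp_psfun (HBic C) (HBic E) (Psf (Hstar_fun D G)) (Psf (Hstar_fun C F)),
     DecF = comp_functor (C0 C) (F0 G) (F0 F)\<rparr>"
proof -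
  interpret F: double_functor C D F by fact
  interpret E: double_category E by fact
  note S = F.C.HBic_simps F.D.HBic_simps E.HBic_simps F.C.bcomp_pairs_HBic(1)
  have "P1 (Psf (Hstar_fun C (comp_dbl_fun C E G F))) =
      comp_functor (B1 (HBic C)) (P1 (Psf (Hstar_fun D G))) (P1 (Psf (Hstar_fun C F)))"
    by (rule fctr.equality)
      (auto simp: Hstar_fun_def comp_dbl_fun_def comp_functor_def S fun_eq_iff compose_def
        F.F1_globular F.C.globular_cell)
  moreover have "FUnit (comp_dbl_fun C E G F) =
      PUnit (comp_psfun (HBic C) (HBic E) (Psf (Hstar_fun D G)) (Psf (Hstar_fun C F)))"
    by (auto simp: comp_psfun_def Hstar_fun_simps comp_dbl_fun_def S fun_eq_iff F.F_cells)
  moreover have "FMult (comp_dbl_fun C E G F) =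
      PMult (comp_psfun (HBic C) (HBic E) (Psf (Hstar_fun D G)) (Psf (Hstar_fun C F)))"
    by (auto simp: comp_psfun_def Hstar_fun_simps comp_dbl_fun_def S fun_eq_iff
        F.F_cells F.C.comp_pairs_simps)
  moreover have "ObF (F0 (comp_dbl_fun C E G F)) =
      P0 (comp_psfun (HBic C) (HBic E) (Psf (Hstar_fun D G)) (Psf (Hstar_fun C F)))"
    by (simp add: comp_psfun_def Hstar_fun_simps comp_dbl_fun_def S comp_functor_def)
  moreover have "F0 (comp_dbl_fun C E G F) = comp_functor (C0 C) (F0 G) (F0 F)"
    by (simp add: comp_dbl_fun_def)
  ultimately show ?thesis
    by (intro dec_psfun.equality psfun.equality) (simp_all add: Hstar_fun_simps comp_psfun_simps)
qed

lemma double_functor_id: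
  assumes "double_category C"
  shows "double_functor C C (id_dbl_fun C)"
proof -
  interpret double_category C by fact
  have i: "F0 (id_dbl_fun C) = id_functor (C0 C)" "F1 (id_dbl_fun C) = id_functor (C1 C)"
    by (simp_all add: id_dbl_fun_def)
  have ar: "ArF (id_functor A) \<alpha> = \<alpha>" if "\<alpha> \<in> Arr A" for A \<alpha>
    using that by (simp add: id_functor_def)
  show ?thesis
  proof (rule double_functorI[OF assms assms], unfold i, goal_cases)
    case 5 then show ?case
      using pseudofunctor_id[OF bicategory_HBic] by (simp add: Hstar_fun_id)
  next
    case (8 v) then show ?case
      by (simp add: ar id_dbl_fun_def HId.ArF_Arr HId.Dom_ArF HId.Cod_ArF Src.B.Dom_Obj Src.B.Cod_Obj
          Src.A.Comp_Id' Src.A.Id_Comp')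
  next
    case (9 \<beta> \<alpha>)
    then have "(Dom (C1 C) \<beta>, Dom (C1 C) \<alpha>) \<in> Obj (comp_pairs C)"
        "(Cod (C1 C) \<beta>, Cod (C1 C) \<alpha>) \<in> Obj (comp_pairs C)"
      using HComp.A.Dom_Obj[OF 9] HComp.A.Cod_Obj[OF 9] by (simp_all add: comp_pairs_simps)
    with 9 show ?case
      by (simp add: ar id_dbl_fun_def hcomp_square comp_pairs_simps Src.A.Comp_Id' Src.A.Id_Comp')
  qed (simp_all add: cat_functor_id ext_functor_id Src.A.category_axioms Src.B.category_axioms
      ar Src.ArF_Arr Tgt.ArF_Arr)
qed

lemma double_functor_comp:
  assumes "double_functor C D F" "double_functor D E G"
  shows "double_functor C E (comp_dbl_fun C E G F)"
proof -
  interpret F: double_functor C D F by fact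
  interpret G: double_functor D E G by fact
  have i: "F0 (comp_dbl_fun C E G F) = comp_functor (C0 C) (F0 G) (F0 F)"
      "F1 (comp_dbl_fun C E G F) = comp_functor (C1 C) (F1 G) (F1 F)"
    by (simp_all add: comp_dbl_fun_def)
  have ar: "ArF (comp_functor A K H) \<alpha> = ArF K (ArF H \<alpha>)" if "\<alpha> \<in> Arr A" for A K H \<alpha>
    using that by (simp add: comp_functor_def compose_def)
  note assoc = G.D.Src.A.Comp_assoc
  show ?thesis
  proof (rule double_functorI[OF F.C.double_category_axioms G.D.double_category_axioms],
      unfold i, goal_cases)
    case 1 show ?case by (rule cat_functor_comp[OF F.F0.cat_functor_axioms G.F0.cat_functor_axioms])
  next
    case 2 show ?case by (rule cat_functor_comp[OF F.F1.cat_functor_axioms G.F1.cat_functor_axioms])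
  next
    case 5 show ?case
      using pseudofunctor_comp[OF F.pseudofunctor_Hstar_fun G.pseudofunctor_Hstar_fun]
      by (simp add: Hstar_fun_comp[OF assms(1) G.D.double_category_axioms])
  next
    \<comment> \<open>For general \<open>v\<close> the horizontal identity is not globular, so the
      pseudofunctor law is silent here. The naturality of the units of \<open>G\<close> and of
      \<open>F\<close> is pasted instead, the latter under \<open>F1 G\<close>.\<close>
    case (8 v)
    note [simp] = F.C.Src.B.Dom_Obj F.C.Src.B.Cod_Obj F.F0.ObF_Obj F.F0.ArF_Arr F.F0.Dom_ArF
      F.F0.Cod_ArF F.F_cells G.F_cells G.F1.ArF_Arr G.F1.Dom_ArF G.F1.Cod_ArF G.F0.ArF_Arr
      G.F0.Dom_ArF G.F0.Cod_ArF F.C.HId.ArF_Arr F.C.HId.Dom_ArF F.C.HId.Cod_ArF F.D.HId.ArF_Arr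
      F.D.HId.Dom_ArF F.D.HId.Cod_ArF G.D.HId.ArF_Arr G.D.HId.Dom_ArF G.D.HId.Cod_ArF F.F1.ArF_Arr
      F.F1.Dom_ArF F.F1.Cod_ArF
    let ?d = "Dom (C0 C) v" and ?c = "Cod (C0 C) v"
    have "ArF (F1 G) (FUnit F ?c) \<cdot>\<^bsub>C1 E\<^esub> FUnit G (ObF (F0 F) ?c) \<cdot>\<^bsub>C1 E\<^esub>
          ArF (HId E) (ArF (F0 G) (ArF (F0 F) v)) =
        ArF (F1 G) (FUnit F ?c \<cdot>\<^bsub>C1 D\<^esub> ArF (HId D) (ArF (F0 F) v)) \<cdot>\<^bsub>C1 E\<^esub> FUnit G (ObF (F0 F) ?d)"
      using 8 G.FUnit_natural[of "ArF (F0 F) v"] by (simp add: G.F1.ArF_Comp assoc)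
    also have "\<dots> = ArF (F1 G) (ArF (F1 F) (ArF (HId C) v)) \<cdot>\<^bsub>C1 E\<^esub>
        ArF (F1 G) (FUnit F ?d) \<cdot>\<^bsub>C1 E\<^esub> FUnit G (ObF (F0 F) ?d)"
      using 8 F.FUnit_natural[of v] by (simp add: G.F1.ArF_Comp assoc)
    finally show ?case
      using 8 by (simp add: ar comp_dbl_fun_def assoc)
  next
    case (9 \<beta> \<alpha>)
    then have ty: "\<beta> \<in> Arr (C1 C)" "\<alpha> \<in> Arr (C1 C)" "ArF (Src C) \<beta> = ArF (Tgt C) \<alpha>"
      by (simp_all add: F.C.comp_pairs_simps)
    \<comment> \<open>The common vertical edge of \<alpha> and \<beta> need not be an identity; its
      domain and codomain give the two matching conditions separately.\<close>
    have obj: "ObF (Src C) (Dom (C1 C) \<beta>) = ObF (Tgt C) (Dom (C1 C) \<alpha>)"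
        "ObF (Src C) (Cod (C1 C) \<beta>) = ObF (Tgt C) (Cod (C1 C) \<alpha>)"
      using ty F.C.Src.Dom_ArF F.C.Src.Cod_ArF F.C.Tgt.Dom_ArF F.C.Tgt.Cod_ArF by metis+
    note [simp] = F.C.Src.A.Dom_Obj F.C.Src.A.Cod_Obj F.F1.ObF_Obj F.F1.ArF_Arr F.F1.Dom_ArF
      F.F1.Cod_ArF F.F_cells G.F_cells G.F1.ArF_Arr G.F1.Dom_ArF G.F1.Cod_ArF
      F.Src_F1 F.Tgt_F1 G.Src_F1 G.Tgt_F1 F.C.hcomp_square F.D.hcomp_square G.D.hcomp_square
      F.C.comp_pairs_simps(1,2) F.D.comp_pairs_simps(1,2)
    let ?d = "FMult F (Dom (C1 C) \<beta>, Dom (C1 C) \<alpha>)" and ?c = "FMult F (Cod (C1 C) \<beta>, Cod (C1 C) \<alpha>)"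
    let ?d' = "FMult G (ObF (F1 F) (Dom (C1 C) \<beta>), ObF (F1 F) (Dom (C1 C) \<alpha>))"
      and ?c' = "FMult G (ObF (F1 F) (Cod (C1 C) \<beta>), ObF (F1 F) (Cod (C1 C) \<alpha>))"
    have "ArF (F1 G) ?c \<cdot>\<^bsub>C1 E\<^esub> ?c' \<cdot>\<^bsub>C1 E\<^esub>
          (ArF (F1 G) (ArF (F1 F) \<beta>) \<odot>\<^bsub>HComp E\<^esub> ArF (F1 G) (ArF (F1 F) \<alpha>)) =
        ArF (F1 G) (?c \<cdot>\<^bsub>C1 D\<^esub> (ArF (F1 F) \<beta> \<odot>\<^bsub>HComp D\<^esub> ArF (F1 F) \<alpha>)) \<cdot>\<^bsub>C1 E\<^esub> ?d'"
      using ty obj G.FMult_natural[of "ArF (F1 F) \<beta>" "ArF (F1 F) \<alpha>"] by (simp add: G.F1.ArF_Comp assoc)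
    also have "\<dots> = ArF (F1 G) (ArF (F1 F) (\<beta> \<odot>\<^bsub>HComp C\<^esub> \<alpha>)) \<cdot>\<^bsub>C1 E\<^esub> ArF (F1 G) ?d \<cdot>\<^bsub>C1 E\<^esub> ?d'"
      using ty obj F.FMult_natural[of \<beta> \<alpha>] by (simp add: G.F1.ArF_Comp assoc)
    finally show ?case
      using ty obj by (simp add: ar comp_dbl_fun_def assoc)
  qed (simp_all add: ext_functor_comp ar F.F1.ArF_Arr F.Src_F1 F.Tgt_F1 G.Src_F1 G.Tgt_F1
      F.C.Src.ArF_Arr F.C.Tgt.ArF_Arr)
qed

lemma comp_dbl_fun_id:
  assumes "double_functor C D F"
  shows "comp_dbl_fun C D (id_dbl_fun D) F = F" "comp_dbl_fun C D F (id_dbl_fun C) = F"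
proof -
  interpret F: double_functor C D F by fact
  note F0 = comp_functor_id_left[OF F.F0.cat_functor_axioms F.ext(1)] comp_functor_id_right[OF F.ext(1)]
  note F1 = comp_functor_id_left[OF F.F1.cat_functor_axioms F.ext(2)] comp_functor_id_right[OF F.ext(2)]
  have id: "dbl_fun.F0 (id_dbl_fun C) = id_functor (C0 C)" "dbl_fun.F0 (id_dbl_fun D) = id_functor (C0 D)"
    by (simp_all add: id_dbl_fun_def)
  note psf = comp_psfun_id[OF F.pseudofunctor_Hstar_fun]
  show "comp_dbl_fun C D (id_dbl_fun D) F = F"
  proof (rule dbl_fun_eqI[of C])
    show "Hstar_fun C (comp_dbl_fun C D (id_dbl_fun D) F) = Hstar_fun C F"
      unfolding Hstar_fun_comp[OF assms F.D.double_category_axioms]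
      by (rule dec_psfun.equality) (simp_all add: Hstar_fun_id psf F0 id Hstar_fun_simps(1))
  qed (simp add: comp_dbl_fun_def id_dbl_fun_def F1)
  show "comp_dbl_fun C D F (id_dbl_fun C) = F"
  proof (rule dbl_fun_eqI[of C])
    show "Hstar_fun C (comp_dbl_fun C D F (id_dbl_fun C)) = Hstar_fun C F"
      unfolding Hstar_fun_comp[OF double_functor_id[OF F.C.double_category_axioms] F.D.double_category_axioms]
      by (rule dec_psfun.equality) (simp_all add: Hstar_fun_id psf F0 id Hstar_fun_simps(1))
  qed (simp add: comp_dbl_fun_def id_dbl_fun_def F1)
qed

lemma comp_dbl_fun_assoc:
  assumes "double_functor C D F" "double_functor D E G" "double_functor E K H"
  shows "comp_dbl_fun C K (comp_dbl_fun D K H G) F = comp_dbl_fun C K H (comp_dbl_fun C E G F)"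
proof (rule dbl_fun_eqI[of C])
  interpret F: double_functor C D F by fact
  interpret G: double_functor D E G by fact
  interpret H: double_functor E K H by fact
  note comp = Hstar_fun_comp[OF assms(1) H.D.double_category_axioms]
    Hstar_fun_comp[OF assms(1) G.D.double_category_axioms]
    Hstar_fun_comp[OF assms(2) H.D.double_category_axioms]
    Hstar_fun_comp[OF double_functor_comp[OF assms(1,2)] H.D.double_category_axioms]
  show "Hstar_fun C (comp_dbl_fun C K (comp_dbl_fun D K H G) F) =
      Hstar_fun C (comp_dbl_fun C K H (comp_dbl_fun C E G F))"
    unfolding comp
    using comp_psfun_assoc[OF F.pseudofunctor_Hstar_fun G.pseudofunctor_Hstar_fun
        H.pseudofunctor_Hstar_fun] comp_functor_assoc[OF F.F0.cat_functor_axioms]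
    by (simp add: comp_dbl_fun_def)
  show "F1 (comp_dbl_fun C K (comp_dbl_fun D K H G) F) =
      F1 (comp_dbl_fun C K H (comp_dbl_fun C E G F))"
    using comp_functor_assoc[OF F.F1.cat_functor_axioms] by (simp add: comp_dbl_fun_def)
qed

lemma category_dblCat: "category dblCat"
proof (unfold_locales, goal_cases)
  case (1 f) then show ?case
    by (auto simp: dblCat_def double_functor_def)
next
  case (2 f) then show ?case
    by (auto simp: dblCat_def double_functor_def)
next
  case (3 a) then show ?case
    by (simp add: dblCat_def double_functor_id)
next
  case (6 f g) then show ?case
    by (auto simp: dblCat_def double_functor_comp)
next
  case (9 f) then show ?case
    by (auto simp: dblCat_def comp_dbl_fun_id)
next
  case (10 f) then show ?case
    by (auto simp: dblCat_def comp_dbl_fun_id)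
next
  case (11 f g h) then show ?case
    by (auto simp: dblCat_def intro: comp_dbl_fun_assoc)
qed (auto simp: dblCat_def)

lemma cat_functor_Hstar: "cat_functor dblCat bCat_dec Hstar"
proof (intro cat_functor.intro category_dblCat category_bCat_dec cat_functor_axioms.intro, goal_cases)
  case (1 C) then show ?case
    by (simp add: dblCat_def bCat_dec_def Hstar_def double_category.decorated_bicategory_Hstar_obj)
next
  case (2 f) then show ?case
    by (auto simp: dblCat_def bCat_dec_def Hstar_def double_functor.decorated_pseudofunctor_Hstar_fun)
next
  case (5 C) then show ?case
    by (simp add: dblCat_def bCat_dec_def Hstar_def Hstar_fun_id Hstar_obj_def)
next
  case (6 f g)
  obtain C F D where f: "f = (C, F, D)" by (cases f)
  obtain D' G E where g: "g = (D', G, E)" by (cases g)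
  from 6 have "double_functor C D F" "double_category E" "D' = D"
    by (auto simp: f g dblCat_def double_functor_def)
  then show ?case
    by (simp add: f g dblCat_def bCat_dec_def Hstar_def Hstar_obj_def Hstar_fun_comp Hstar_fun_simps(1))
qed (auto simp: dblCat_def bCat_dec_def Hstar_def)

lemma cat_functor_full_subcat:
  assumes "cat_functor A B F"
  shows "cat_functor (full_subcat A X) B F"
proof -
  interpret cat_functor A B F by fact
  show ?thesis
    by (intro cat_functor.intro category_full_subcat A.category_axioms B.category_axioms
        cat_functor_axioms.intro)
      (simp_all add: full_subcat_def ObF_Obj ArF_Arr Dom_ArF Cod_ArF ArF_Id ArF_Comp)
qed

section \<open>Faithfulness\<close>

text \<open>The conclusion carries membership in \<open>Arr (C1 C)\<close> because the rules
  \<open>vert\<close> and \<open>horiz\<close> do not state it, while functoriality and naturality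
  require it of the components.\<close>

lemma F1_eq_on_generated_squares:
  assumes "double_functor C D F" "double_functor C D G" "Hstar_fun C F = Hstar_fun C G"
    and "\<alpha> \<in> generated_squares C"
  shows "\<alpha> \<in> Arr (C1 C) \<and> ArF (F1 F) \<alpha> = ArF (F1 G) \<alpha>"
  using assms(4)
proof induction
  interpret F: double_functor C D F by fact
  interpret G: double_functor C D G by fact
  have eq: "F0 G = F0 F" "ObF (F1 G) = ObF (F1 F)" "FUnit G = FUnit F" "FMult G = FMult F"
      "restrict (ArF (F1 G)) (globular C) = restrict (ArF (F1 F)) (globular C)"
    using assms(3) by (simp_all add: Hstar_fun_def)
  {
    case (glob \<alpha>) then show ?case
      using fun_cong[OF eq(5), of \<alpha>] F.C.globular_cell(1) by simp
  next
    case (hid v)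
    \<comment> \<open>The naturality equations of \<open>F\<close> and \<open>G\<close> have the
      same left side, as they share \<open>F0\<close> and \<open>FUnit\<close>. Equating the right
      sides leaves the invertible cell at \<open>Dom (C0 C) v\<close> to be cancelled.\<close>
    have "ArF (F1 F) (ArF (HId C) v) \<cdot>\<^bsub>C1 D\<^esub> FUnit F (Dom (C0 C) v) =
        ArF (F1 G) (ArF (HId C) v) \<cdot>\<^bsub>C1 D\<^esub> FUnit F (Dom (C0 C) v)"
      using F.FUnit_natural[OF hid] G.FUnit_natural[OF hid] unfolding eq by metis
    then have "ArF (F1 F) (ArF (HId C) v) = ArF (F1 G) (ArF (HId C) v)"
      by (rule F.D.Src.A.iso_arr_cancel[rotated -1])
        (use hid in \<open>simp_all add: eq(1,2) F.FUnit_cell F.F1.ArF_Arr G.F1.ArF_Arr F.F1.Dom_ArF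
          G.F1.Dom_ArF F.C.HId.ArF_Arr F.C.HId.Dom_ArF F.C.Src.B.Dom_Obj\<close>)
    with hid show ?case
      by (simp add: F.C.HId.ArF_Arr)
  next
    case (vert \<alpha> \<beta>) then show ?case
      by (simp add: F.C.Src.A.Comp_Arr F.F1.ArF_Comp G.F1.ArF_Comp)
  next
    case (horiz \<alpha> \<beta>)
    then have ty: "(\<beta>, \<alpha>) \<in> Arr (comp_pairs C)"
      by (simp add: F.C.comp_pairs_simps)
    then have obj: "(Dom (C1 C) \<beta>, Dom (C1 C) \<alpha>) \<in> Obj (comp_pairs C)"
      using F.C.HComp.A.Dom_Obj[OF ty] by (simp add: F.C.comp_pairs_simps)
    have IH: "ArF (F1 G) \<beta> = ArF (F1 F) \<beta>" "ArF (F1 G) \<alpha> = ArF (F1 F) \<alpha>"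
      using horiz by simp_all
    \<comment> \<open>Here the left sides coincide by the induction hypotheses and the shared
      \<open>FMult\<close>; \<open>obj\<close> supplies invertibility of the cell that is cancelled
      next.\<close>
    have "ArF (F1 F) (\<beta> \<odot>\<^bsub>HComp C\<^esub> \<alpha>) \<cdot>\<^bsub>C1 D\<^esub> FMult F (Dom (C1 C) \<beta>, Dom (C1 C) \<alpha>) =
        ArF (F1 G) (\<beta> \<odot>\<^bsub>HComp C\<^esub> \<alpha>) \<cdot>\<^bsub>C1 D\<^esub> FMult F (Dom (C1 C) \<beta>, Dom (C1 C) \<alpha>)"
      using F.FMult_natural[OF ty] G.FMult_natural[OF ty] unfolding eq IH by metis
    then have "ArF (F1 F) (\<beta> \<odot>\<^bsub>HComp C\<^esub> \<alpha>) = ArF (F1 G) (\<beta> \<odot>\<^bsub>HComp C\<^esub> \<alpha>)"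
      by (rule F.D.Src.A.iso_arr_cancel[rotated -1])
        (use horiz obj in \<open>simp_all add: eq(2) F.FMult_cell F.F1.ArF_Arr G.F1.ArF_Arr F.F1.Dom_ArF
          G.F1.Dom_ArF F.C.hcomp_square\<close>)
    with horiz show ?case
      by (simp add: F.C.hcomp_square)
  }
qed

lemma Hstar_fun_inj:
  assumes "double_functor C D F" "double_functor C D G" "globularly_generated C"
    and "Hstar_fun C F = Hstar_fun C G"
  shows "F = G"
proof (rule dbl_fun_eqI[OF assms(4)], rule fctr.equality)
  interpret F: double_functor C D F by fact
  interpret G: double_functor C D G by fact
  show "ObF (F1 F) = ObF (F1 G)"
    using assms(4) by (simp add: Hstar_fun_def)
  \<comment> \<open>On \<open>Arr (C1 C)\<close> every square is generated; outside it both actions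
    are \<open>undefined\<close>.\<close>
  show "ArF (F1 F) = ArF (F1 G)"
    using F.ext(2) G.ext(2) F1_eq_on_generated_squares[OF assms(1,2,4)] assms(3)
    by (intro extensionalityI[where A = "Arr (C1 C)"]) (auto simp: ext_functor_def globularly_generated_def)
qed simp

theorem proposition5p5:
  shows "faithful_functor
    (gCat :: (('o, 'v, 'h, 's) dbl_cat, ('o, 'v, 'h, 's) dbl_mor) cat)
    (bCat_dec :: (('o, 'v, 'h, 's) dec_bicat, ('o, 'v, 'h, 's) dec_mor) cat)
    Hstar"
proof (intro faithful_functor.intro faithful_functor_axioms.intro)
  show "cat_functor (gCat :: (('o, 'v, 'h, 's) dbl_cat, ('o, 'v, 'h, 's) dbl_mor) cat) bCat_dec Hstar"
    unfolding gCat_def by (rule cat_functor_full_subcat[OF cat_functor_Hstar])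
next
  fix f g :: "('o, 'v, 'h, 's) dbl_mor"
  assume fg: "f \<in> Arr gCat" "g \<in> Arr gCat" "Dom gCat f = Dom gCat g" "Cod gCat f = Cod gCat g"
    and eq: "ArF Hstar f = ArF Hstar g"
  obtain C F D where f: "f = (C, F, D)" by (cases f)
  obtain C' G D' where g: "g = (C', G, D')" by (cases g)
  from fg have "C' = C" "D' = D" "double_functor C D F" "double_functor C D G"
      "globularly_generated C"
    by (auto simp: f g gCat_def full_subcat_def dblCat_def)
  with eq Hstar_fun_inj[of C D F G] show "f = g"
    by (simp add: f g Hstar_def)
qed

end
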